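(* Let $G$ be a torsion non-abelian group such that $\mathcal{GP}(G)$ is complete. If $G$ is locally finite, then $G$ is a (possibly infinite) generalized quaternion group.
   Context: For a group $G$, the generalized power graph $\mathcal{GP}(G)$ is the simple undirected graph whose vertices are the non-identity elements of $G$, two distinct vertices $a,b$ being adjacent if and only if $\langle a\rangle\cap\langle b\rangle\neq 1$. A graph is complete if any two distinct vertices are adjacent. A group is locally finite if each of its finitely generated subgroups is finite. The finite generalized quaternion groups are $Q_{2^n}=\langle x,y \mid x^{2^{n-1}}=1,\ y^2=x^{2^{n-2}},\ y^{-1}xy=x^{-1}\rangle$ for $n\ge 3$. The infinite generalized quaternion group is $Q_{2^\infty}=\langle A,y\rangle$, where $A\cong\mathbb{Z}_{2^\infty}$ (the Prüfer $2$-group) has index $2$, $y^{-1}ay=a^{-1}$ for all $a\in A$, and $y^2$ is the unique element of order $2$ in $A$ (equivalently, it is the ascending union of the groups $Q_{2^n}$). *)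

theory Defs
  imports
    Complex_Main
    "HOL-Algebra.Elementary_Groups"
    "HOL-Algebra.Multiplicative_Group"
    "Graph_Theory.Pair_Digraph"
begin

section \<open>Generalized power graphs\<close>

text \<open>
  A simple undirected graph is a loop-free \<^typ>\<open>'a pair_pre_digraph\<close> whose arc relation is
  symmetric (see the lemmas below). The bundled notions of graph of the library are not used
  because they require finiteness.
\<close>

definition generalized_power_graph :: "('a, 'b) monoid_scheme \<Rightarrow> 'a pair_pre_digraph" where
  "generalized_power_graph G =
     \<lparr> pverts = carrier G - {\<one>\<^bsub>G\<^esub>},
       parcs = {(a, b). a \<in> carrier G - {\<one>\<^bsub>G\<^esub>} \<and> b \<in> carrier G - {\<one>\<^bsub>G\<^esub>} \<and> a \<noteq> b \<and>
                        generate G {a} \<inter> generate G {b} \<noteq> {\<one>\<^bsub>G\<^esub>}} \<rparr>"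

definition complete_graph :: "'a pair_pre_digraph \<Rightarrow> bool" where
  "complete_graph \<Gamma> \<longleftrightarrow>
     (\<forall>u \<in> pverts \<Gamma>. \<forall>v \<in> pverts \<Gamma>. u \<noteq> v \<longrightarrow> (u, v) \<in> parcs \<Gamma>)"

lemma sym_generalized_power_graph: "sym (parcs (generalized_power_graph G))"
  by (auto simp: generalized_power_graph_def sym_def)

lemma irrefl_generalized_power_graph: "irrefl (parcs (generalized_power_graph G))"
  by (auto simp: generalized_power_graph_def irrefl_def)

section \<open>Torsion and locally finite groups\<close>

definition torsion_group :: "('a, 'b) monoid_scheme \<Rightarrow> bool" where
  "torsion_group G \<longleftrightarrow> group G \<and> (\<forall>x \<in> carrier G. \<exists>n::nat. n > 0 \<and> x [^]\<^bsub>G\<^esub> n = \<one>\<^bsub>G\<^esub>)"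

definition locally_finite_group :: "('a, 'b) monoid_scheme \<Rightarrow> bool" where
  "locally_finite_group G \<longleftrightarrow>
     group G \<and> (\<forall>S. S \<subseteq> carrier G \<and> finite S \<longrightarrow> finite (generate G S))"

section \<open>Groups given by generators and relations\<close>

text \<open>
  The generators are all elements of the type \<open>'g\<close>. The letter \<open>(g, False)\<close> stands for the
  generator \<open>g\<close> and \<open>(g, True)\<close> for its formal inverse. A relation \<open>u = v\<close> is the pair \<open>(u, v)\<close>.
\<close>

type_synonym 'g word = "('g \<times> bool) list"

inductive pres_eq :: "('g word \<times> 'g word) set \<Rightarrow> 'g word \<Rightarrow> 'g word \<Rightarrow> bool" for R where
  rel: "(u, v) \<in> R \<Longrightarrow> pres_eq R u v"
| cancel: "pres_eq R [(g, b), (g, \<not> b)] []"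
| refl: "pres_eq R u u"
| sym: "pres_eq R u v \<Longrightarrow> pres_eq R v u"
| trans: "pres_eq R u v \<Longrightarrow> pres_eq R v w \<Longrightarrow> pres_eq R u w"
| cong: "pres_eq R u u' \<Longrightarrow> pres_eq R v v' \<Longrightarrow> pres_eq R (u @ v) (u' @ v')"

definition pres_class :: "('g word \<times> 'g word) set \<Rightarrow> 'g word \<Rightarrow> 'g word set" where
  "pres_class R u = {v. pres_eq R u v}"

definition presented_group :: "('g word \<times> 'g word) set \<Rightarrow> 'g word set monoid" where
  "presented_group R =
     \<lparr> carrier = range (pres_class R),
       monoid.mult = (\<lambda>X Y. \<Union>u \<in> X. \<Union>v \<in> Y. pres_class R (u @ v)),
       one = pres_class R [] \<rparr>"

lemma pres_class_eq_iff: "pres_class R u = pres_class R v \<longleftrightarrow> pres_eq R u v"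
proof
  assume "pres_class R u = pres_class R v"
  moreover have "v \<in> pres_class R v"
    by (simp add: pres_class_def pres_eq.refl)
  ultimately have "v \<in> pres_class R u"
    by simp
  then show "pres_eq R u v"
    by (simp add: pres_class_def)
next
  assume uv: "pres_eq R u v"
  then have vu: "pres_eq R v u"
    by (rule pres_eq.sym)
  show "pres_class R u = pres_class R v"
    unfolding pres_class_def using pres_eq.trans[OF uv] pres_eq.trans[OF vu] by blast
qed

lemma presented_group_mult:
  "pres_class R u \<otimes>\<^bsub>presented_group R\<^esub> pres_class R v = pres_class R (u @ v)"
proof -
  have "pres_class R (u' @ v') = pres_class R (u @ v)"
    if "u' \<in> pres_class R u" "v' \<in> pres_class R v" for u' v'
  proof -
    have "pres_eq R (u @ v) (u' @ v')"
      using that by (intro pres_eq.cong) (simp_all add: pres_class_def)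
    then show ?thesis
      by (simp add: pres_class_eq_iff pres_eq.sym)
  qed
  moreover have "u \<in> pres_class R u" "v \<in> pres_class R v"
    by (simp_all add: pres_class_def pres_eq.refl)
  ultimately have "(\<Union>u' \<in> pres_class R u. \<Union>v' \<in> pres_class R v. pres_class R (u' @ v')) =
      pres_class R (u @ v)"
    by blast
  then show ?thesis
    by (simp add: presented_group_def)
qed

lemma pres_eq_inverse: "\<exists>v. pres_eq R (v @ u) []"
proof (induction u)
  case Nil
  have "pres_eq R ([] @ []) []"
    by (simp add: pres_eq.refl)
  then show ?case ..
next
  case (Cons l u)
  obtain g b where l: "l = (g, b)" by force
  from Cons obtain v where v: "pres_eq R (v @ u) []" by blast
  have "pres_eq R ([(g, \<not> b), (g, b)] @ u) ([] @ u)"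
    using pres_eq.cancel[of R g "\<not> b"] by (intro pres_eq.cong pres_eq.refl) simp
  then have "pres_eq R (v @ [(g, \<not> b), (g, b)] @ u) (v @ u)"
    using pres_eq.cong[OF pres_eq.refl[of R v]] by simp
  from pres_eq.trans[OF this v] have "pres_eq R ((v @ [(g, \<not> b)]) @ l # u) []"
    by (simp add: l)
  then show ?case ..
qed

lemma group_presented_group: "group (presented_group R)"
proof (rule groupI)
  show "\<one>\<^bsub>presented_group R\<^esub> \<in> carrier (presented_group R)"
    by (simp add: presented_group_def)
next
  fix X Y
  assume "X \<in> carrier (presented_group R)" "Y \<in> carrier (presented_group R)"
  then obtain u v where "X = pres_class R u" "Y = pres_class R v"
    by (auto simp: presented_group_def)
  then show "X \<otimes>\<^bsub>presented_group R\<^esub> Y \<in> carrier (presented_group R)"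
    by (simp only: presented_group_mult) (simp add: presented_group_def)
next
  fix X Y Z
  assume "X \<in> carrier (presented_group R)" "Y \<in> carrier (presented_group R)"
    "Z \<in> carrier (presented_group R)"
  then obtain u v w where "X = pres_class R u" "Y = pres_class R v" "Z = pres_class R w"
    by (auto simp: presented_group_def)
  then show "X \<otimes>\<^bsub>presented_group R\<^esub> Y \<otimes>\<^bsub>presented_group R\<^esub> Z =
      X \<otimes>\<^bsub>presented_group R\<^esub> (Y \<otimes>\<^bsub>presented_group R\<^esub> Z)"
    by (simp add: presented_group_mult)
next
  fix X
  assume "X \<in> carrier (presented_group R)"
  then obtain u where u: "X = pres_class R u"
    by (auto simp: presented_group_def)
  have one: "\<one>\<^bsub>presented_group R\<^esub> = pres_class R []"
    by (simp add: presented_group_def)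
  show "\<one>\<^bsub>presented_group R\<^esub> \<otimes>\<^bsub>presented_group R\<^esub> X = X"
    by (simp add: u one presented_group_mult)
  obtain v where "pres_eq R (v @ u) []"
    using pres_eq_inverse by blast
  then have "pres_class R v \<otimes>\<^bsub>presented_group R\<^esub> X = \<one>\<^bsub>presented_group R\<^esub>"
    by (simp add: u one presented_group_mult pres_class_eq_iff)
  moreover have "pres_class R v \<in> carrier (presented_group R)"
    by (simp add: presented_group_def)
  ultimately show "\<exists>Y \<in> carrier (presented_group R).
      Y \<otimes>\<^bsub>presented_group R\<^esub> X = \<one>\<^bsub>presented_group R\<^esub>"
    by blast
qed

section \<open>Generalized quaternion groups\<close>

datatype quaternion_gen = GenX | GenY

text \<open>
  The relations are \<open>x ^ (2 ^ (n - 1)) = 1\<close>, \<open>y\<^sup>2 = x ^ (2 ^ (n - 2))\<close> and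
  \<open>y\<inverse> x y = x\<inverse>\<close>. The parameter is the exponent: the group of order \<open>2 ^ n\<close>.
\<close>

definition quaternion_relations :: "nat \<Rightarrow> (quaternion_gen word \<times> quaternion_gen word) set" where
  "quaternion_relations n =
     {(replicate (2 ^ (n - 1)) (GenX, False), []),
      ([(GenY, False), (GenY, False)], replicate (2 ^ (n - 2)) (GenX, False)),
      ([(GenY, True), (GenX, False), (GenY, False)], [(GenX, True)])}"

definition quaternion_group :: "nat \<Rightarrow> quaternion_gen word set monoid" where
  "quaternion_group n = presented_group (quaternion_relations n)"

text \<open>The Pruefer 2-group, realized as the complex roots of unity of 2-power order.\<close>

definition pruefer_2_group :: "complex monoid" where
  "pruefer_2_group = \<lparr> carrier = {z. \<exists>k::nat. z ^ (2 ^ k) = 1}, monoid.mult = (*), one = 1 \<rparr>"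

definition infinite_generalized_quaternion :: "('a, 'b) monoid_scheme \<Rightarrow> bool" where
  "infinite_generalized_quaternion G \<longleftrightarrow> group G \<and>
     (\<exists>A y. subgroup A G \<and> y \<in> carrier G \<and>
        carrier G = generate G (insert y A) \<and>
        subgroup_generated G A \<cong> pruefer_2_group \<and>
        card (rcosets\<^bsub>G\<^esub> A) = 2 \<and>
        (\<forall>a \<in> A. inv\<^bsub>G\<^esub> y \<otimes>\<^bsub>G\<^esub> a \<otimes>\<^bsub>G\<^esub> y = inv\<^bsub>G\<^esub> a) \<and>
        {a \<in> A. group.ord G a = 2} = {y [^]\<^bsub>G\<^esub> (2::nat)})"

definition generalized_quaternion :: "('a, 'b) monoid_scheme \<Rightarrow> bool" where
  "generalized_quaternion G \<longleftrightarrow>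
     (\<exists>n \<ge> 3. G \<cong> quaternion_group n) \<or> infinite_generalized_quaternion G"

end

(*
  By completeness all nontrivial cyclic subgroups meet, so they share one subgroup of prime order p,
  generated by z, and all element orders are powers of p. Suppose that a subgroup C has at most one
  cyclic subgroup of each order p^l with l <= k, and let a, b in C have order p^(k+1). In the finite
  p-group <a, b> some g outside <a^p> is central modulo <a^p>; multiplying h by a power of g to kill
  h^p shows that every h of order p^(k+1) lies in <g>. The commutator correction d^(p(p-1)/2) is
  harmless if p is odd or k >= 2. For odd p this makes G abelian, and for p = 2 it makes the
  centralizer A of any element i of order 4 abelian.

  For p = 2 an element i of order 4 that commutes with everything up to the central involution z
  exists in every finite nonabelian subgroup, and one compares these to find one for all of G. Then A
  has index 2, every y outside A satisfies y^2 = z and inverts A, and A is either cyclic or Pruefer.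
*)
theory Submission
  imports
    Defs
    "HOL-Algebra.Group_Action"
    "HOL-Algebra.Sylow"
begin

section \<open>Finite p-groups\<close>

text \<open>The obstacle is \<open>Q_8\<close>: it has one involution but three cyclic subgroups of
  order 4, so the passage from order 2 to order 4 must fail in general. This is the only bad step,
  since for \<open>p = 2\<close> and \<open>k = 1\<close> the exponent \<open>p (p - 1) / 2\<close>
  equals 1 and no factor \<open>p\<close> is left to absorb the commutator. Restricting to the
  centralizer of an element of order 4 restores precisely this level.

  The choice of \<open>i\<close> is delicate because not every element of order 4 will do. In
  \<open>Q_8\<close> all of them commute modulo \<open>z\<close> with everything, but from
  \<open>Q_16\<close> on only those inside the cyclic subgroup of index 2 do. These are powers of
  elements of order at least 8, so such an element is preferred whenever \<open>G\<close> contains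
  one.

  Local finiteness matters because central elements modulo a subgroup come from the class equation.
  Uniqueness of cyclic subgroups concerns two elements at a time, so finite subgroups such as
  \<open><a, b>\<close> suffice to prove it.\<close>

lemma prime_power_if_unique_prime_factor:
  fixes n p :: nat
  assumes "n > 0" "prime p" and unique: "\<And>q. prime q \<Longrightarrow> q dvd n \<Longrightarrow> q = p"
  obtains k where "n = p ^ k"
proof -
  have "\<not> is_unit p"
    using \<open>prime p\<close> not_prime_unit by blast
  then obtain m where m: "n = p ^ multiplicity p n * m" "\<not> p dvd m"
    using multiplicity_decompose'[of n p] \<open>n > 0\<close> by auto
  have "m = 1"
  proof (rule ccontr)
    assume "m \<noteq> 1"
    then obtain q where "prime q" "q dvd m"
      using prime_factor_nat by blast
    then show False
      using unique m by (metis dvd_mult)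
  qed
  then show ?thesis
    using that m by simp
qed

text \<open>This is the class equation: if only the identity were central, every other conjugacy
  class would have size divisible by \<open>p\<close>, and \<open>p^n\<close> would be 1 modulo
  \<open>p\<close>.\<close>

lemma (in group) nontrivial_center_if_prime_power_order:
  fixes p :: nat
  assumes p: "prime p" and order: "order G = p ^ n" and n: "n > 0"
  obtains g where "g \<in> carrier G" "g \<noteq> \<one>" "\<And>h. h \<in> carrier G \<Longrightarrow> g \<otimes> h = h \<otimes> g"
proof (rule ccontr)
  assume "\<not> thesis"
  with that have noncentral: "\<exists>h \<in> carrier G. g \<otimes> h \<noteq> h \<otimes> g" if "g \<in> carrier G" "g \<noteq> \<one>" for g
    using \<open>g \<in> carrier G\<close> \<open>g \<noteq> \<one>\<close> by blast
  define \<phi> where "\<phi> = (\<lambda>g. \<lambda>h \<in> carrier G. g \<otimes> h \<otimes> inv g)"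
  interpret conj: group_action G "carrier G" \<phi>
    unfolding \<phi>_def by (rule action_by_conjugation)
  have fin: "finite (carrier G)"
    using order p order_gt_0_iff_finite prime_gt_0_nat by force
  let ?O = "orbits G (carrier G) \<phi>"
  have one: "{\<one>} \<in> ?O"
  proof -
    have "orbit G \<phi> \<one> = {\<one>}"
      by (force simp: orbit_def \<phi>_def)
    then show ?thesis
      unfolding orbits_def by force
  qed
  have dvd: "p dvd card Y" if Y: "Y \<in> ?O - {{\<one>}}" for Y
  proof -
    obtain x where x: "x \<in> carrier G" "Y = orbit G \<phi> x"
      using Y by (auto simp: orbits_def)
    have xY: "x \<in> Y"
      using conj.orbit_refl x by simp
    have "x \<noteq> \<one>"
    proof
      assume "x = \<one>"
      then show False
        using conj.disjoint_union[of Y "{\<one>}"] one Y xY by auto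
    qed
    then obtain h where h: "h \<in> carrier G" "x \<otimes> h \<noteq> h \<otimes> x"
      using noncentral x by blast
    have "h \<otimes> x \<otimes> inv h \<in> Y"
      using x h by (auto simp: orbit_def \<phi>_def)
    moreover have "h \<otimes> x \<otimes> inv h \<noteq> x"
      using x h by (metis inv_solve_right m_closed)
    moreover have finY: "finite Y"
      using Y fin conj.orbits_coverture by (metis DiffD1 Sup_upper finite_subset)
    ultimately have "card Y \<noteq> 1"
      using xY by (metis card_1_singletonE singletonD)
    moreover have "card Y dvd p ^ n"
      using conj.orbit_stabilizer_theorem[OF x(1)] x(2) order by (metis dvd_triv_left)
    ultimately show ?thesis
      using p by (metis divides_primepow_nat dvd_power gr0I power_0)
  qed
  have finO: "finite ?O"
    using fin by (simp add: orbits_def)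
  have "sum card ?O = sum (sum (\<lambda>_. 1)) ?O"
    by (intro sum.cong) auto
  also have "\<dots> = order G"
    using conj.disjoint_sum[OF fin, of "\<lambda>_. 1 :: nat"] by (simp add: order_def)
  finally have "order G = sum card ?O"
    by simp
  also have "sum card ?O = card {\<one>} + sum card (?O - {{\<one>}})"
    using sum.remove[OF finO one] by blast
  finally have "p ^ n = 1 + sum card (?O - {{\<one>}})"
    using order by simp
  moreover have "p dvd sum card (?O - {{\<one>}})"
    by (rule dvd_sum) (rule dvd)
  moreover have "p dvd p ^ n"
    using n by simp
  ultimately have "p dvd 1"
    by (metis dvd_add_left_iff)
  then show False
    using p by (metis not_prime_unit)
qed

text \<open>Cauchy's theorem, taken from \<open>sylow_thm\<close> with exponent 1, realizes each
  prime divisor \<open>q\<close> of the order as the order of an element, so \<open>q\<close>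
  divides a power of \<open>p\<close>.\<close>

lemma (in group) prime_power_order_if_prime_power_exponents:
  fixes p :: nat
  assumes p: "prime p" and fin: "finite (carrier G)"
    and exp: "\<And>g. g \<in> carrier G \<Longrightarrow> \<exists>k::nat. g [^] (p ^ k) = \<one>"
  obtains n where "order G = p ^ n"
proof (rule prime_power_if_unique_prime_factor[OF _ p, of "order G"])
  show "order G > 0"
    using fin order_gt_0_iff_finite by blast
  fix q assume q: "prime q" "q dvd order G"
  then obtain m where "order G = q ^ 1 * m"
    by auto
  then obtain K where K: "subgroup K G" "card K = q ^ 1"
    using sylow_thm[OF q(1) is_group _ fin] by blast
  interpret K: group "G\<lparr>carrier := K\<rparr>"
    using K(1) by (rule subgroup_imp_group)
  have "K \<noteq> {\<one>}"
    using K(2) q(1) by (auto simp: prime_nat_iff)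
  then obtain x where x: "x \<in> K" "x \<noteq> \<one>"
    using subgroup.one_closed[OF K(1)] by blast
  have xG: "x \<in> carrier G"
    using K(1) x(1) by (rule subgroup.mem_carrier)
  have "x [^]\<^bsub>G\<lparr>carrier := K\<rparr>\<^esub> order (G\<lparr>carrier := K\<rparr>) = \<one>\<^bsub>G\<lparr>carrier := K\<rparr>\<^esub>"
    using x by (intro K.pow_order_eq_1) simp
  then have "x [^] q = \<one>"
    using K(2) by (simp add: order_def flip: nat_pow_consistent)
  then have "ord x dvd q"
    using xG by (simp add: pow_eq_id)
  moreover have "ord x \<noteq> 1"
    using x xG ord_eq_1 by blast
  ultimately have "ord x = q"
    using q(1) by (auto simp: prime_nat_iff)
  moreover obtain k where "x [^] (p ^ k) = \<one>"
    using exp xG by blast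
  ultimately have "q dvd p ^ k"
    using xG by (simp add: pow_eq_id)
  then show "q = p"
    using q(1) p by (metis prime_dvd_power primes_dvd_imp_eq)
qed (use that in blast)

text \<open>The quotient of \<open>H\<close> by the central subgroup \<open>U\<close> is a
  nontrivial p-group, and \<open>g\<close> represents a nontrivial element of its center. Centrality
  is unfolded into a correction \<open>c\<close> in \<open>U\<close>, so that the applications work
  with elements alone.\<close>

lemma (in group) exists_central_modulo:
  fixes p :: nat
  assumes p: "prime p" and H: "subgroup H G" "finite H"
    and exp: "\<And>h. h \<in> H \<Longrightarrow> \<exists>k::nat. h [^] (p ^ k) = \<one>"
    and U: "subgroup U G" "U \<subset> H"
    and central: "\<And>u h. u \<in> U \<Longrightarrow> h \<in> H \<Longrightarrow> u \<otimes> h = h \<otimes> u"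
  obtains g where "g \<in> H" "g \<notin> U" "\<And>h. h \<in> H \<Longrightarrow> \<exists>c \<in> U. g \<otimes> h = c \<otimes> (h \<otimes> g)"
proof -
  let ?K = "G\<lparr>carrier := H\<rparr>"
  interpret K: group ?K
    using H(1) by (rule subgroup_imp_group)
  have HG: "h \<in> carrier G" if "h \<in> H" for h
    using subgroup.mem_carrier[OF H(1) that] .
  have UK: "subgroup U ?K"
    using U H by (intro subgroup_incl) auto
  have "U \<lhd> ?K"
    using UK central by (intro K.normalI) (auto simp: r_coset_def l_coset_def)
  then interpret U: normal U ?K .
  let ?Q = "?K Mod U"
  interpret Q: group ?Q
    by (rule U.factorgroup_is_group)
  obtain n where n: "order ?K = p ^ n"
    using H(2) exp
    by (auto simp flip: nat_pow_consistent
        intro: K.prime_power_order_if_prime_power_exponents[OF p])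
  have lagrange: "order ?Q * card U = order ?K"
    using K.lagrange[OF UK] by (simp add: order_def FactGroup_def)
  then obtain m where m: "order ?Q = p ^ m"
    using n p by (metis divides_primepow_nat dvd_triv_left)
  have "card U < card H"
    using U H by (simp add: psubset_card_mono)
  then have "order ?Q \<noteq> 1"
    using lagrange order_def[of ?K] by auto
  then have "m > 0"
    using m by (cases m) auto
  then obtain X where X: "X \<in> carrier ?Q" "X \<noteq> \<one>\<^bsub>?Q\<^esub>"
    and Xc: "\<And>Y. Y \<in> carrier ?Q \<Longrightarrow> X \<otimes>\<^bsub>?Q\<^esub> Y = Y \<otimes>\<^bsub>?Q\<^esub> X"
    using Q.nontrivial_center_if_prime_power_order[OF p m] by blast
  obtain g where g: "g \<in> H" "X = U #>\<^bsub>?K\<^esub> g"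
    using X(1) by (auto simp: FactGroup_def RCOSETS_def)
  have "g \<notin> U"
    using X(2) g U.rcos_const by (auto simp: FactGroup_def)
  moreover have "\<exists>c \<in> U. g \<otimes> h = c \<otimes> (h \<otimes> g)" if h: "h \<in> H" for h
  proof -
    have "U #>\<^bsub>?K\<^esub> h \<in> carrier ?Q"
      using h by (auto simp: FactGroup_def RCOSETS_def)
    from Xc[OF this] have "U #>\<^bsub>?K\<^esub> (g \<otimes> h) = U #>\<^bsub>?K\<^esub> (h \<otimes> g)"
      using U.rcos_sum[of g h] U.rcos_sum[of h g] g h by (simp add: FactGroup_def)
    moreover have "g \<otimes> h \<in> U #>\<^bsub>?K\<^esub> (g \<otimes> h)"
      using K.rcos_self[OF _ UK] K.m_closed g h by simp
    ultimately show ?thesis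
      by (auto simp: r_coset_def)
  qed
  ultimately show ?thesis
    using that g by blast
qed

section \<open>Cyclic subgroups and their generators\<close>

lemma (in group) nat_pow_mem_subgroup:
  "subgroup H G \<Longrightarrow> h \<in> H \<Longrightarrow> h [^] (n::nat) \<in> H"
  by (metis int_pow_int subgroup_int_pow_closed)

lemma (in group) mem_generate_singleton_iff:
  assumes "a \<in> carrier G" "ord a \<noteq> 0"
  shows "b \<in> generate G {a} \<longleftrightarrow> (\<exists>n::nat. b = a [^] n)"
  using generate_pow_nat[OF assms] by auto

lemma (in group) generate_singleton_mono:
  assumes "a \<in> carrier G" "b \<in> generate G {a}"
  shows "generate G {b} \<subseteq> generate G {a}"
  using assms by (intro generate_subgroup_incl generate_is_subgroup) auto

lemma (in group) generate_singleton_sym: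
  assumes a: "a \<in> carrier G" and "ord b = ord a" "ord a \<noteq> 0" and b: "b \<in> generate G {a}"
  shows "a \<in> generate G {b}"
proof -
  have bG: "b \<in> carrier G"
    using a b generate_incl[of "{a}"] by auto
  have "generate G {b} = generate G {a}"
  proof (rule card_subset_eq)
    show "finite (generate G {a})"
      using assms generate_pow_card[OF a] by (metis card.infinite)
  qed (use assms generate_pow_card[OF a] generate_pow_card[OF bG] generate_singleton_mono in auto)
  then show ?thesis
    by (simp add: generate.incl)
qed

lemma (in group) commute_generate_singleton:
  assumes a: "a \<in> carrier G" and h: "h \<in> carrier G" and comm: "a \<otimes> h = h \<otimes> a"
    and b: "b \<in> generate G {a}"
  shows "b \<otimes> h = h \<otimes> b"
proof -
  have "b \<otimes> h = h \<otimes> b \<and> b \<in> carrier G"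
    using b
  proof induction
    case (eng x y)
    then show ?case
      using h by (metis m_assoc m_closed)
  next
    case (inv x)
    then show ?case
      using a h comm by (metis inv_closed inv_solve_left' inv_solve_right m_assoc m_closed singletonD)
  qed (use a h comm in auto)
  then show ?thesis ..
qed

section \<open>Groups with a unique subgroup of prime order\<close>

lemma (in group) pow_commutator:
  assumes G: "d \<in> carrier G" "h \<in> carrier G" "v \<in> carrier G"
    and vh: "v \<otimes> h = d \<otimes> (h \<otimes> v)" and dv: "d \<otimes> v = v \<otimes> d"
  shows "v [^] (n::nat) \<otimes> h = d [^] n \<otimes> (h \<otimes> v [^] n)"
proof (induction n)
  case (Suc n)
  have "v [^] Suc n \<otimes> h = v [^] n \<otimes> (d \<otimes> (h \<otimes> v))"
    using G vh by (simp add: m_assoc)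
  also have "\<dots> = d \<otimes> (v [^] n \<otimes> h) \<otimes> v"
    using G dv pow_mult_distrib by (metis (no_types, lifting) group_commutes_pow m_assoc m_closed nat_pow_closed)
  also have "\<dots> = d \<otimes> d [^] n \<otimes> (h \<otimes> v [^] Suc n)"
    using G Suc by (simp add: m_assoc)
  finally show ?case
    by (simp only: nat_pow_Suc2[OF G(1)])
qed (use G in simp)

text \<open>This is the power formula of nilpotency class 2, with \<open>d\<close> the commutator of
  \<open>v\<close> and \<open>h\<close>: a new factor \<open>h\<close> has to pass
  \<open>v^i\<close>, which contributes \<open>d^i\<close>.\<close>

lemma (in group) pow_mult_commutator:
  assumes G: "d \<in> carrier G" "h \<in> carrier G" "v \<in> carrier G"
    and vh: "v \<otimes> h = d \<otimes> (h \<otimes> v)" and dv: "d \<otimes> v = v \<otimes> d" and dh: "d \<otimes> h = h \<otimes> d"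
  shows "(h \<otimes> v) [^] (n::nat) = d [^] (\<Sum>i<n. i) \<otimes> (h [^] n \<otimes> v [^] n)"
proof (induction n)
  case (Suc n)
  let ?s = "\<Sum>i<n. i"
  have comm: "h [^] n \<otimes> d [^] n = d [^] n \<otimes> h [^] n"
    using G dh by (metis group_commutes_pow nat_pow_closed)
  have "(h \<otimes> v) [^] Suc n = d [^] ?s \<otimes> (h [^] n \<otimes> (v [^] n \<otimes> h) \<otimes> v)"
    using G Suc by (simp add: m_assoc)
  also have "\<dots> = d [^] ?s \<otimes> ((h [^] n \<otimes> d [^] n) \<otimes> (h \<otimes> v [^] n) \<otimes> v)"
    using G pow_commutator[OF G vh dv] by (simp add: m_assoc)
  also have "\<dots> = (d [^] ?s \<otimes> d [^] n) \<otimes> (h [^] n \<otimes> h \<otimes> (v [^] n \<otimes> v))"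
    unfolding comm using G by (simp add: m_assoc)
  finally show ?case
    using G by (simp add: nat_pow_mult)
qed (use G in simp)

text \<open>These assumptions are what remains of the graph: \<open><z>\<close> lies in every
  nontrivial cyclic subgroup, so it is the only subgroup of order \<open>p\<close>. Torsion is
  contained in \<open>locally_finite\<close>, applied to a single element.\<close>

locale unique_prime_order_group = group G for G (structure) +
  fixes p :: nat and z
  assumes prime_p: "prime p" and z_closed: "z \<in> carrier G" and ord_z: "ord z = p"
    and z_mem: "\<And>g. g \<in> carrier G \<Longrightarrow> g \<noteq> \<one> \<Longrightarrow> z \<in> generate G {g}"
    and locally_finite: "\<And>S. S \<subseteq> carrier G \<Longrightarrow> finite S \<Longrightarrow> finite (generate G S)"
begin

lemma ord_nonzero:
  assumes "g \<in> carrier G"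
  shows "ord g \<noteq> 0"
  using assms locally_finite[of "{g}"] generate.one[of G "{g}"] generate_pow_card[OF assms]
  by auto

text \<open>If a prime \<open>q\<close> divides \<open>ord g\<close>, some power of \<open>g\<close>
  has order \<open>q\<close>, and its cyclic subgroup contains \<open>z\<close>; hence
  \<open>p\<close> divides \<open>q\<close>.\<close>

lemma ord_prime_power:
  assumes g: "g \<in> carrier G"
  obtains k where "ord g = p ^ k"
proof (rule prime_power_if_unique_prime_factor[OF _ prime_p, of "ord g"])
  show "ord g > 0"
    using ord_nonzero[OF g] by simp
  fix q assume q: "prime q" "q dvd ord g"
  let ?g = "g [^] (ord g div q)"
  have gG: "?g \<in> carrier G"
    using g by simp
  have ord: "ord ?g = q"
    using g q ord_nonzero[OF g] by (subst ord_pow) auto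
  then have "?g \<noteq> \<one>"
    using q(1) by auto
  then obtain n where "z = ?g [^] (n::nat)"
    using z_mem[OF gG] mem_generate_singleton_iff[OF gG ord_nonzero[OF gG]] by auto
  then have "z [^] q = \<one>"
    using gG ord by (metis mult.commute nat_pow_one nat_pow_pow pow_ord_eq_1)
  then have "p dvd q"
    using z_closed ord_z pow_eq_id by blast
  then show "q = p"
    using prime_p q(1) primes_dvd_imp_eq by blast
qed (use that in blast)

lemma exponent_prime_mem:
  assumes g: "g \<in> carrier G" "g [^] p = \<one>"
  shows "g \<in> generate G {z}"
proof (cases "g = \<one>")
  case False
  then have "ord g = p"
    using g prime_p by (metis ord_eq_1 pow_eq_id prime_nat_iff)
  then show ?thesis
    using generate_singleton_sym[OF g(1), of z] z_mem[OF g(1) False] ord_z ord_nonzero[OF g(1)]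
    by simp
qed (simp add: generate.one)

section \<open>Uniqueness of cyclic subgroups, one order at a time\<close>

text \<open>The condition says "at most one": it is vacuous if no element of \<open>C\<close> has
  order \<open>n\<close>, and exchanging \<open>a\<close> and \<open>b\<close> gives equality of the
  cyclic subgroups.\<close>

definition one_cyclic_of_order :: "'a set \<Rightarrow> nat \<Rightarrow> bool" where
  "one_cyclic_of_order C n \<longleftrightarrow>
     (\<forall>a \<in> C. \<forall>b \<in> C. ord a = n \<longrightarrow> ord b = n \<longrightarrow> b \<in> generate G {a})"

lemma one_cyclic_of_orderD:
  "one_cyclic_of_order C n \<Longrightarrow> a \<in> C \<Longrightarrow> b \<in> C \<Longrightarrow> ord a = n \<Longrightarrow> ord b = n \<Longrightarrow>
    b \<in> generate G {a}"
  by (auto simp: one_cyclic_of_order_def)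

lemma ord_pow_prime_power:
  assumes "a \<in> carrier G" "ord a = p ^ n" "m \<le> n"
  shows "ord (a [^] (p ^ m)) = p ^ (n - m)"
proof -
  have "p ^ m dvd p ^ n" "p ^ m \<noteq> 0" "p \<noteq> 0"
    using assms(3) prime_p by (auto simp: le_imp_power_dvd)
  then show ?thesis
    using ord_pow[OF assms(1), of "p ^ m"] assms(2,3) power_diff[of p m n] by simp
qed

text \<open>The powers of \<open>u\<close> already supply an element of every order
  \<open>p^l\<close> with \<open>l <= k\<close>, so uniqueness at level \<open>l\<close> puts
  \<open>g\<close> among them.\<close>

lemma one_cyclic_mem:
  assumes C: "subgroup C G" and level: "\<And>l. l \<le> k \<Longrightarrow> one_cyclic_of_order C (p ^ l)"
    and u: "u \<in> C" "ord u = p ^ k" and g: "g \<in> C" "g [^] (p ^ k) = \<one>"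
  shows "g \<in> generate G {u}"
proof -
  have G: "u \<in> carrier G" "g \<in> carrier G"
    using C u g subgroup.mem_carrier by metis+
  obtain l where l: "l \<le> k" "ord g = p ^ l"
    using g(2) G divides_primepow_nat[OF prime_p] by (auto simp: pow_eq_id)
  let ?w = "u [^] (p ^ (k - l))"
  have "ord ?w = p ^ l"
    using ord_pow_prime_power[OF G(1) u(2), of "k - l"] l by simp
  moreover have "?w \<in> C"
    using C u(1) by (rule nat_pow_mem_subgroup)
  ultimately have "g \<in> generate G {?w}"
    using one_cyclic_of_orderD[OF level[OF l(1)] _ g(1)] l by blast
  moreover have "?w \<in> generate G {u}"
    using mem_generate_singleton_iff[OF G(1) ord_nonzero[OF G(1)]] by blast
  ultimately show ?thesis
    using generate_singleton_mono[OF G(1)] by blast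
qed

text \<open>By uniqueness the subgroups \<open><u>\<close> and \<open><h>\<close> are comparable:
  the element of smaller order lies in the subgroup of the other.\<close>

lemma one_cyclic_central:
  assumes C: "subgroup C G" and level: "\<And>l. l \<le> k \<Longrightarrow> one_cyclic_of_order C (p ^ l)"
    and u: "u \<in> C" "ord u = p ^ k" and h: "h \<in> C"
  shows "u \<otimes> h = h \<otimes> u"
proof -
  have G: "u \<in> carrier G" "h \<in> carrier G"
    using C u h subgroup.mem_carrier by metis+
  obtain m where m: "ord h = p ^ m"
    using ord_prime_power[OF G(2)] .
  show ?thesis
  proof (cases "m \<le> k")
    case True
    then have "h [^] (p ^ k) = \<one>"
      using m G by (simp add: pow_eq_id le_imp_power_dvd)
    then have "h \<in> generate G {u}"
      using one_cyclic_mem[OF C level u h] by blast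
    then show ?thesis
      using commute_generate_singleton[OF G(1) G(1) HOL.refl, of h] by simp
  next
    case False
    let ?w = "h [^] (p ^ (m - k))"
    have "ord ?w = p ^ k"
      using ord_pow_prime_power[OF G(2) m, of "m - k"] False by simp
    moreover have "?w \<in> C"
      using C h by (rule nat_pow_mem_subgroup)
    ultimately have "u \<in> generate G {?w}"
      using one_cyclic_of_orderD[OF level[OF order.refl] _ u(1)] u by blast
    moreover have "?w \<in> generate G {h}"
      using mem_generate_singleton_iff[OF G(2) ord_nonzero[OF G(2)]] by blast
    ultimately have "u \<in> generate G {h}"
      using generate_singleton_mono[OF G(2)] by blast
    then show ?thesis
      using commute_generate_singleton[OF G(2) G(2) HOL.refl] by simp
  qed
qed

text \<open>Two elements of order \<open>p^(k+1)\<close> are not compared directly, but both with a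
  third one, \<open>g\<close>, that is central modulo \<open><a^p>\<close>. Level \<open>k\<close>
  makes \<open><a^p>\<close> central in \<open>C\<close>, so commutators with \<open>g\<close>
  behave like scalars. Among \<open>k >= 1\<close> only \<open>p = 2\<close>, \<open>k = 1\<close>
  is left out, where \<open>Q_8\<close> is a counterexample.\<close>

lemma one_cyclic_step:
  assumes C: "subgroup C G" and level: "\<And>l. l \<le> k \<Longrightarrow> one_cyclic_of_order C (p ^ l)"
    and k: "k \<ge> 1" "odd p \<or> k \<ge> 2"
  shows "one_cyclic_of_order C (p ^ Suc k)"
  unfolding one_cyclic_of_order_def
proof (intro ballI impI)
  fix a b assume ab: "a \<in> C" "b \<in> C" and ord_a: "ord a = p ^ Suc k" and ord_b: "ord b = p ^ Suc k"
  have CG: "x \<in> carrier G" if "x \<in> C" for x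
    using C that by (rule subgroup.mem_carrier)
  let ?H = "generate G {a, b}"
  have H: "subgroup ?H G" "finite ?H" "?H \<subseteq> C" "a \<in> ?H" "b \<in> ?H"
    using ab CG generate_subgroup_incl[OF _ C, of "{a, b}"]
    by (auto simp: generate.incl generate_is_subgroup intro!: locally_finite)
  have HC: "x \<in> C" if "x \<in> ?H" for x
    using H(3) that by blast
  have ord_p: "ord (x [^] p) = p ^ k" if "x \<in> C" "ord x = p ^ Suc k" for x
    using ord_pow_prime_power[OF CG[OF that(1)] that(2), of 1] by simp
  define u where "u = a [^] p"
  have u: "u \<in> C" "ord u = p ^ k" "u \<in> ?H"
    using ab ord_a ord_p C H nat_pow_mem_subgroup by (auto simp: u_def)
  let ?U = "generate G {u}"
  have U: "subgroup ?U G" "?U \<subseteq> ?H"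
    using u CG generate_is_subgroup generate_subgroup_incl[OF _ H(1), of "{u}"] by auto
  have U_central: "w \<otimes> h = h \<otimes> w" if "w \<in> ?U" "h \<in> C" for w h
    using commute_generate_singleton[OF CG[OF u(1)] CG[OF that(2)] _ that(1)]
      one_cyclic_central[OF C level u(1,2) that(2)] by blast
  have "a \<notin> ?U"
  proof
    assume "a \<in> ?U"
    then obtain n where "a = u [^] (n::nat)"
      using mem_generate_singleton_iff CG u ord_nonzero by metis
    then have "a [^] (p ^ k) = \<one>"
      using CG[OF u(1)] u(2) by (metis mult.commute nat_pow_one nat_pow_pow pow_ord_eq_1)
    then have "p ^ Suc k dvd p ^ k"
      using ord_a CG[OF ab(1)] by (metis pow_eq_id)
    then show False
      using prime_gt_1_nat[OF prime_p] by (simp add: dvd_imp_le power_dvd_imp_le le_def nat_dvd_not_less)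
  qed
  then have "?U \<subset> ?H"
    using U H by blast
  moreover have "\<exists>n::nat. h [^] (p ^ n) = \<one>" if "h \<in> ?H" for h
    using ord_prime_power[OF CG[OF HC[OF that]]] CG[OF HC[OF that]] by (metis pow_ord_eq_1)
  ultimately obtain g0 where g0: "g0 \<in> ?H" "g0 \<notin> ?U"
      "\<And>h. h \<in> ?H \<Longrightarrow> \<exists>c \<in> ?U. g0 \<otimes> h = c \<otimes> (h \<otimes> g0)"
    using exists_central_modulo[OF prime_p H(1,2) _ U(1)] U_central HC by metis
  obtain m where m: "ord g0 = p ^ m"
    using ord_prime_power CG HC g0(1) by metis
  \<comment> \<open>Elements of \<open>C\<close> of exponent \<open>p^k\<close> all lie in
    \<open><u>\<close>, and \<open>g0\<close> does not.\<close>
  have "m > k"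
  proof (rule ccontr)
    assume "\<not> m > k"
    then have "g0 [^] (p ^ k) = \<one>"
      using m CG HC g0(1) by (simp add: pow_eq_id le_imp_power_dvd)
    then show False
      using one_cyclic_mem[OF C level u(1,2)] HC g0 by blast
  qed
  \<comment> \<open>Being central modulo \<open><u>\<close> passes to powers, so \<open>g0\<close>
    may be replaced by a power of exact order \<open>p^(k+1)\<close>.\<close>
  have g0_pow: "\<exists>c \<in> ?U. g0 [^] (n::nat) \<otimes> h = c \<otimes> (h \<otimes> g0 [^] n)" if h: "h \<in> ?H" for n h
  proof -
    obtain c where c: "c \<in> ?U" "g0 \<otimes> h = c \<otimes> (h \<otimes> g0)"
      using g0(3) h by blast
    then have "g0 [^] n \<otimes> h = c [^] n \<otimes> (h \<otimes> g0 [^] n)"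
      using pow_commutator[of c h g0] U_central[OF c(1)] HC h g0(1) U CG by blast
    then show ?thesis
      using nat_pow_mem_subgroup[OF U(1) c(1)] by blast
  qed
  define g where "g = g0 [^] (p ^ (m - Suc k))"
  have g: "g \<in> C" "g \<in> ?H" "ord g = p ^ Suc k"
    using ord_pow_prime_power[OF _ m, of "m - Suc k"] \<open>m > k\<close> CG HC g0(1)
      nat_pow_mem_subgroup[OF H(1) g0(1)] by (auto simp: g_def)
  note g_mem = mem_generate_singleton_iff[OF CG[OF g(1)] ord_nonzero[OF CG[OF g(1)]]]
  have gen_g: "subgroup (generate G {g}) G"
    using CG g by (auto intro: generate_is_subgroup)
  have mem_g: "h \<in> generate G {g}" if h: "h \<in> ?H" "ord h = p ^ Suc k" for h
  proof -
    note hG = CG[OF HC[OF h(1)]]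
    have "h [^] p \<in> generate G {g [^] p}"
      using one_cyclic_of_orderD[OF level[OF order.refl]] ord_p g h HC C nat_pow_mem_subgroup
      by metis
    moreover have "g [^] p \<in> carrier G"
      using CG g by simp
    ultimately obtain j where j: "h [^] p = (g [^] p) [^] (j::nat)"
      using mem_generate_singleton_iff ord_nonzero by metis
    \<comment> \<open>The aim is a power \<open>v\<close> of \<open>g\<close> with
      \<open>v^p\<close> inverse to \<open>h^p\<close>; the inverse of \<open>g^j\<close> is
      rewritten with a natural exponent \<open>i\<close>.\<close>
    have "inv (g [^] j) \<in> generate G {g}"
      using gen_g g_mem by (metis subgroup.m_inv_closed)
    then obtain i where i: "inv (g [^] j) = g [^] (i::nat)"
      using g_mem by blast
    define v where "v = g [^] i"
    have v: "v \<in> C" "v \<in> ?H" "v \<in> generate G {g}"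
      using g H HC nat_pow_mem_subgroup g_mem by (auto simp: v_def)
    note vG = CG[OF v(1)]
    have hv: "h [^] p \<otimes> v [^] p = \<one>"
      using j i g CG by (metis mult.commute nat_pow_closed nat_pow_inv nat_pow_pow r_inv v_def)
    obtain d where d: "d \<in> ?U" "v \<otimes> h = d \<otimes> (h \<otimes> v)"
      using g0_pow[OF h(1), of "p ^ (m - Suc k) * i"] CG HC g0(1)
      by (auto simp: v_def g_def nat_pow_pow)
    have dG: "d \<in> carrier G"
      using d U HC CG by blast
    have dv: "d \<otimes> v = v \<otimes> d" and dh: "d \<otimes> h = h \<otimes> d"
      using U_central d v h HC by blast+
    \<comment> \<open>Being inverse to \<open>h^p\<close>, the power \<open>v^p\<close> commutes
      with \<open>h\<close>, so the factor \<open>d^p\<close> collected on its way past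
      \<open>h\<close> must be trivial.\<close>
    have "v [^] p = inv (h [^] p)"
      using hv hG vG by (metis inv_unique' nat_pow_closed inv_comm)
    then have "v [^] p \<otimes> h = h \<otimes> v [^] p"
      using hG by (metis (no_types, lifting) inv_solve_left' inv_solve_right m_assoc nat_pow_Suc nat_pow_Suc2 nat_pow_closed m_closed inv_closed)
    then have "d [^] p \<otimes> (h \<otimes> v [^] p) = h \<otimes> v [^] p"
      using pow_commutator[OF dG hG vG d(2) dv] by simp
    then have dp: "d [^] p = \<one>"
      using dG hG vG by (metis m_closed nat_pow_closed r_cancel_one)
    let ?s = "\<Sum>i<p. i"
    have hvp: "(h \<otimes> v) [^] p = d [^] ?s"
      using pow_mult_commutator[OF dG hG vG d(2) dv dh, of p] hv dG by simp
    \<comment> \<open>Here \<open>?s\<close> is \<open>p (p - 1) / 2\<close>, divisible by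
      \<open>p\<close> if \<open>p\<close> is odd; for \<open>k >= 2\<close> the factor
      \<open>p^(k - 1)\<close> is divisible instead.\<close>
    have "p dvd ?s * p ^ (k - 1)"
    proof (cases "k \<ge> 2")
      case False
      then have "odd p"
        using k by blast
      have "2 * ?s = p * (p - 1)"
        by (induction p) (auto simp: algebra_simps)
      then have "p dvd 2 * ?s"
        by simp
      then show ?thesis
        using \<open>odd p\<close> by (metis coprime_dvd_mult_right_iff coprime_right_2_iff_odd dvd_mult2)
    qed (auto simp: dvd_mult dvd_power)
    then have "d [^] (?s * p ^ (k - 1)) = \<one>"
      using dp dG by (metis nat_pow_one nat_pow_pow dvdE)
    then have "(h \<otimes> v) [^] (p * p ^ (k - 1)) = \<one>"
      using hvp dG hG vG by (metis m_closed nat_pow_pow)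
    then have "(h \<otimes> v) [^] (p ^ k) = \<one>"
      using k(1) by (metis One_nat_def Suc_le_D diff_Suc_1 power_Suc)
    moreover have "h \<otimes> v \<in> C"
      using C HC h v by (simp add: subgroup.m_closed)
    \<comment> \<open>The element \<open>h v\<close> has dropped to level \<open>k\<close>, where
      \<open><g^p>\<close> contains everything in \<open>C\<close> of exponent
      \<open>p^k\<close>.\<close>
    ultimately have "h \<otimes> v \<in> generate G {g [^] p}"
      using one_cyclic_mem[OF C level _ ord_p[OF g(1,3)]] C g(1) nat_pow_mem_subgroup by blast
    moreover have "generate G {g [^] p} \<subseteq> generate G {g}"
      using g_mem CG[OF g(1)] by (intro generate_singleton_mono) auto
    ultimately have "h \<otimes> v \<otimes> inv v \<in> generate G {g}"
      using gen_g v by (meson subgroup.m_closed subgroup.m_inv_closed subsetD)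
    then show ?thesis
      using hG vG by (simp add: m_assoc)
  qed
  have "g \<in> generate G {a}"
    using generate_singleton_sym[OF CG[OF g(1)], of a] mem_g[OF H(4) ord_a] ord_a g ord_nonzero CG prime_gt_0_nat[OF prime_p]
    by simp
  from generate_singleton_mono[OF CG[OF ab(1)] this] show "b \<in> generate G {a}"
    using mem_g[OF H(5) ord_b] by (rule subsetD)
qed

end

section \<open>Uniqueness at all levels and commutativity\<close>

context unique_prime_order_group
begin

lemma one_cyclic_of_order_1:
  "C \<subseteq> carrier G \<Longrightarrow> one_cyclic_of_order C 1"
  unfolding one_cyclic_of_order_def using generate.one ord_eq_1 by (metis subsetD)

lemma one_cyclic_of_order_prime:
  assumes "C \<subseteq> carrier G"
  shows "one_cyclic_of_order C p"
  unfolding one_cyclic_of_order_def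
proof (intro ballI impI)
  fix a b assume ab: "a \<in> C" "b \<in> C" "ord a = p" "ord b = p"
  have G: "a \<in> carrier G" "b \<in> carrier G"
    using ab assms by auto
  have "b [^] p = \<one>"
    using G ab by (metis pow_ord_eq_1)
  then have "b \<in> generate G {z}"
    using exponent_prime_mem G by blast
  moreover have "a \<noteq> \<one>"
    using ab(3) prime_p by auto
  then have "z \<in> generate G {a}"
    using z_mem G by blast
  ultimately show "b \<in> generate G {a}"
    using generate_singleton_mono[OF G(1), of z] by blast
qed

text \<open>Levels 0 and 1 always hold. For \<open>p = 2\<close> level 2 has to be supplied, because
  \<open>one_cyclic_step\<close> excludes the step from 1 to 2.\<close>

lemma one_cyclic_all:
  assumes C: "subgroup C G" and base: "odd p \<or> one_cyclic_of_order C (p ^ 2)"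
  shows "one_cyclic_of_order C (p ^ k)"
proof (induction k rule: less_induct)
  case (less k)
  have sub: "C \<subseteq> carrier G"
    using C by (rule subgroup.subset)
  consider "k = 0" | "k = 1" | "k = 2" "even p" | l where "k = Suc l" "l \<ge> 1" "odd p \<or> l \<ge> 2"
    by (cases k) force+
  then show ?case
  proof cases
    case 4
    then show ?thesis
      using one_cyclic_step[OF C, of l] less.IH by auto
  qed (use base sub one_cyclic_of_order_1 one_cyclic_of_order_prime in auto)
qed

lemma commute_if_one_cyclic:
  assumes C: "subgroup C G" and level: "\<And>k. one_cyclic_of_order C (p ^ k)"
    and ab: "a \<in> C" "b \<in> C"
  shows "a \<otimes> b = b \<otimes> a"
  using ord_prime_power[OF subgroup.mem_carrier[OF C ab(1)]] one_cyclic_central[OF C level ab(1) _ ab(2)]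
  by metis

text \<open>This is centrality at level 1: levels 0 and 1 hold on all of \<open>G\<close>, and
  \<open>z\<close> has order \<open>p\<close>.\<close>

lemma z_central:
  assumes "g \<in> carrier G"
  shows "z \<otimes> g = g \<otimes> z"
proof (rule one_cyclic_central[OF subgroup_self, of 1])
  fix l :: nat assume "l \<le> 1"
  then show "one_cyclic_of_order (carrier G) (p ^ l)"
    using one_cyclic_of_order_1 one_cyclic_of_order_prime by (cases l) auto
qed (use assms z_closed ord_z in auto)

definition centralizer :: "'a \<Rightarrow> 'a set" where
  "centralizer i = {g \<in> carrier G. g \<otimes> i = i \<otimes> g}"

lemma subgroup_centralizer:
  assumes i: "i \<in> carrier G"
  shows "subgroup (centralizer i) G"
proof (rule subgroupI)
  fix g assume g: "g \<in> centralizer i"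
  then have "inv g \<in> generate G {g}"
    by (simp add: generate.inv)
  then show "inv g \<in> centralizer i"
    using g i commute_generate_singleton[of g i "inv g"] by (simp add: centralizer_def)
next
  fix g h assume "g \<in> centralizer i" "h \<in> centralizer i"
  then show "g \<otimes> h \<in> centralizer i"
    using i by (simp add: centralizer_def) (metis m_assoc)
qed (use i in \<open>auto simp: centralizer_def\<close>)

end

section \<open>Groups with a unique involution\<close>

locale unique_involution_group = unique_prime_order_group +
  assumes p_eq_2: "p = 2"
begin

lemma z_square: "z \<otimes> z = \<one>"
  using pow_ord_eq_1[OF z_closed] ord_z p_eq_2 by (simp add: numeral_2_eq_2 z_closed)

lemma z_neq_one: "z \<noteq> \<one>"
  using ord_z p_eq_2 by auto

lemma generate_z: "generate G {z} = {\<one>, z}"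
proof
  show "generate G {z} \<subseteq> {\<one>, z}"
  proof
    fix g assume "g \<in> generate G {z}"
    then obtain n where "g = z [^] (n::nat)"
      using mem_generate_singleton_iff z_closed ord_nonzero by metis
    moreover have "z [^] n \<in> {\<one>, z}"
      by (induction n) (auto simp: z_square z_closed)
    ultimately show "g \<in> {\<one>, z}"
      by simp
  qed
qed (auto intro: generate.intros)

lemma square_eq_one:
  "g \<in> carrier G \<Longrightarrow> g \<otimes> g = \<one> \<Longrightarrow> g = \<one> \<or> g = z"
  using exponent_prime_mem[of g] p_eq_2 generate_z by (simp add: numeral_2_eq_2)

lemma order_four_square:
  assumes "i \<in> carrier G" "ord i = 4"
  shows "i \<otimes> i = z"
proof -
  have "i [^] (4::nat) = \<one>" "i [^] (2::nat) \<noteq> \<one>"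
    using assms pow_ord_eq_1[of i] by (auto simp: pow_eq_id)
  then show ?thesis
    using square_eq_one[of "i \<otimes> i"] assms by (auto simp: numeral_eq_Suc m_assoc)
qed

text \<open>If \<open>a^2 = z\<close>, then \<open>(a i)^2 = z z = 1\<close>, so \<open>a i\<close>
  is 1 or \<open>z\<close>, both of which lie in \<open><i>\<close>. If \<open>a^2 = 1\<close>, then
  \<open>a\<close> itself is one of these.\<close>

lemma order_four_mem:
  assumes i: "i \<in> carrier G" "ord i = 4" and a: "a \<in> centralizer i" "a [^] (4::nat) = \<one>"
  shows "a \<in> generate G {i}"
proof -
  have aG: "a \<in> carrier G" and comm: "a \<otimes> i = i \<otimes> a"
    using a by (auto simp: centralizer_def)
  have "i \<noteq> \<one>"
    using i by auto
  then have z: "z \<in> generate G {i}" "\<one> \<in> generate G {i}"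
    using z_mem i generate.one by auto
  have "(a \<otimes> a) \<otimes> (a \<otimes> a) = \<one>"
    using a(2) aG by (simp add: numeral_eq_Suc m_assoc)
  then consider "a \<otimes> a = \<one>" | "a \<otimes> a = z"
    using square_eq_one[of "a \<otimes> a"] aG by auto
  then show ?thesis
  proof cases
    case 1
    then show ?thesis
      using square_eq_one[OF aG] z by auto
  next
    case 2
    have "(a \<otimes> i) \<otimes> (a \<otimes> i) = (a \<otimes> a) \<otimes> (i \<otimes> i)"
      using aG i comm by (metis m_assoc m_closed)
    also have "\<dots> = \<one>"
      using 2 order_four_square[OF i] z_square by simp
    finally have "a \<otimes> i \<in> generate G {i}"
      using square_eq_one[of "a \<otimes> i"] aG i z by auto
    moreover have "inv i \<in> generate G {i}"
      by (simp add: generate.inv)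
    ultimately have "(a \<otimes> i) \<otimes> inv i \<in> generate G {i}"
      by (rule generate.eng)
    then show ?thesis
      using aG i by (simp add: m_assoc)
  qed
qed

text \<open>\<open>order_four_mem\<close> provides the level \<open>p^2 = 4\<close> that
  \<open>one_cyclic_all\<close> demands for \<open>p = 2\<close>.\<close>

lemma order_four_centralizer:
  assumes i: "i \<in> carrier G" "ord i = 4"
  shows "one_cyclic_of_order (centralizer i) (2 ^ k)"
proof -
  have "one_cyclic_of_order (centralizer i) 4"
    unfolding one_cyclic_of_order_def
  proof (intro ballI impI)
    fix a b assume ab: "a \<in> centralizer i" "b \<in> centralizer i" "ord a = 4" "ord b = 4"
    have G: "a \<in> carrier G" "b \<in> carrier G"
      using ab by (auto simp: centralizer_def)
    have "a \<in> generate G {i}" "b \<in> generate G {i}"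
      using order_four_mem[OF i] ab pow_ord_eq_1 G by metis+
    moreover from this have "i \<in> generate G {a}"
      using generate_singleton_sym[of i a] i ab by simp
    ultimately show "b \<in> generate G {a}"
      using generate_singleton_mono[OF G(1), of i] by blast
  qed
  then show ?thesis
    using one_cyclic_all[OF subgroup_centralizer[OF i(1)], of k] p_eq_2 by simp
qed

section \<open>Commuting up to the central involution\<close>

definition commute_mod_z :: "'a \<Rightarrow> 'a \<Rightarrow> bool" where
  "commute_mod_z g h \<longleftrightarrow> g \<otimes> h = h \<otimes> g \<or> g \<otimes> h = z \<otimes> (h \<otimes> g)"

lemma commute_mod_z_sym:
  assumes "g \<in> carrier G" "h \<in> carrier G" "commute_mod_z g h"
  shows "commute_mod_z h g"
proof -
  have "z \<otimes> (z \<otimes> (h \<otimes> g)) = h \<otimes> g"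
    using assms z_closed z_square by (simp flip: m_assoc)
  then show ?thesis
    using assms(3) by (auto simp: commute_mod_z_def)
qed

lemma commute_mod_z_generate:
  assumes "g \<in> carrier G" "h \<in> carrier G" "commute_mod_z g h" "w \<in> generate G {g}"
  shows "commute_mod_z w h"
proof -
  have "\<exists>c \<in> {\<one>, z}. g \<otimes> h = c \<otimes> (h \<otimes> g)"
    using assms(1-3) by (auto simp: commute_mod_z_def)
  then obtain c where c: "c \<in> {\<one>, z}" "g \<otimes> h = c \<otimes> (h \<otimes> g)" ..
  obtain n where n: "w = g [^] (n::nat)"
    using assms mem_generate_singleton_iff ord_nonzero by metis
  have "w \<otimes> h = c [^] n \<otimes> (h \<otimes> w)"
    unfolding n using c assms z_closed z_central by (intro pow_commutator) auto
  moreover have "c [^] n \<in> {\<one>, z}"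
    using c(1) generate_z nat_pow_mem_subgroup[OF generate_is_subgroup[of "{z}"]] z_closed by simp
  moreover have "w \<in> carrier G"
    using n assms(1) by simp
  ultimately show ?thesis
    using assms(2) by (auto simp: commute_mod_z_def)
qed

lemma order_power_two:
  assumes "g \<in> carrier G"
  obtains m where "ord g = 2 ^ m"
  using ord_prime_power[OF assms] p_eq_2 by auto

lemma exists_order_four_power:
  assumes g: "g \<in> carrier G" "ord g = 2 ^ m" "m \<ge> 2"
  shows "g [^] (2 ^ (m - 2) :: nat) \<in> generate G {g}" "ord (g [^] (2 ^ (m - 2) :: nat)) = 4"
  using ord_pow_prime_power[OF g(1), of m "m - 2"] g mem_generate_singleton_iff[OF g(1)] p_eq_2
  by auto

text \<open>Noncommutativity makes \<open><z>\<close> a proper subgroup of \<open>H\<close>. An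
  element central modulo \<open><z>\<close> and outside it has order at least 4, since
  \<open><z>\<close> contains everything of exponent 2; its power of order 4 inherits the
  commutation.\<close>

lemma exists_order_four_commute_mod_z:
  assumes H: "subgroup H G" "finite H" and ab: "a \<in> H" "b \<in> H" "a \<otimes> b \<noteq> b \<otimes> a"
  obtains i where "i \<in> H" "ord i = 4" "\<And>h. h \<in> H \<Longrightarrow> commute_mod_z i h"
proof -
  have HG: "h \<in> carrier G" if "h \<in> H" for h
    using subgroup.mem_carrier[OF H(1) that] .
  have "a \<noteq> \<one>"
    using ab HG by auto
  then have "z \<in> H"
    using z_mem[OF HG[OF ab(1)]] generate_subgroup_incl[OF _ H(1), of "{a}"] ab(1) by auto
  moreover have "a \<notin> {\<one>, z}"
    using ab HG z_central by auto
  ultimately have U: "generate G {z} \<subset> H"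
    using ab(1) subgroup.one_closed[OF H(1)] by (auto simp: generate_z)
  have U_subgroup: "subgroup (generate G {z}) G"
    using z_closed by (simp add: generate_is_subgroup)
  have U_central: "u \<otimes> h = h \<otimes> u" if "u \<in> generate G {z}" "h \<in> H" for u h
    using that z_central HG by (auto simp: generate_z)
  have exp: "\<exists>n::nat. h [^] (2 ^ n :: nat) = \<one>" if "h \<in> H" for h
    using order_power_two[OF HG[OF that]] HG[OF that] by (metis pow_ord_eq_1)
  obtain g where g: "g \<in> H" "g \<notin> generate G {z}"
      "\<And>h. h \<in> H \<Longrightarrow> \<exists>c \<in> generate G {z}. g \<otimes> h = c \<otimes> (h \<otimes> g)"
    using exists_central_modulo[OF two_is_prime_nat H exp U_subgroup U U_central] by blast
  have comm: "commute_mod_z g h" if "h \<in> H" for h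
    using g(3)[OF that] HG g(1) that by (auto simp: generate_z commute_mod_z_def)
  obtain m where m: "ord g = 2 ^ m"
    using order_power_two HG g(1) by blast
  have "m \<ge> 2"
  proof (rule ccontr)
    assume "\<not> m \<ge> 2"
    then have "ord g dvd 2"
      using m by (cases m) auto
    then have "g \<otimes> g = \<one>"
      using HG g(1) by (simp add: numeral_2_eq_2 flip: pow_eq_id)
    then show False
      using square_eq_one HG g by (auto simp: generate_z)
  qed
  note i = exists_order_four_power[OF HG[OF g(1)] m this]
  show ?thesis
  proof (rule that[OF _ i(2)])
    show "g [^] (2 ^ (m - 2) :: nat) \<in> H"
      using H(1) g(1) by (rule nat_pow_mem_subgroup)
    show "commute_mod_z (g [^] (2 ^ (m - 2) :: nat)) h" if "h \<in> H" for h
      using commute_mod_z_generate[OF _ _ comm[OF that] i(1)] HG g(1) that by blast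
  qed
qed

text \<open>The order of \<open>y\<close> cannot exceed 4: otherwise its power \<open>w\<close> of
  order 4 commutes with \<open>i\<close>, so \<open><w> = <i>\<close> by
  \<open>order_four_mem\<close>, and \<open>i\<close> would be a power of \<open>y\<close>. As
  \<open>y\<close> lies outside \<open><z>\<close>, its square is the involution.\<close>

lemma anticommute_square:
  assumes i: "i \<in> carrier G" "ord i = 4" and y: "y \<in> carrier G" "i \<otimes> y = z \<otimes> (y \<otimes> i)"
  shows "y \<otimes> y = z"
proof -
  have not_comm: "i \<otimes> y \<noteq> y \<otimes> i"
    using y i z_closed z_neq_one by (metis m_closed r_cancel_one)
  obtain m where m: "ord y = 2 ^ m"
    using order_power_two y(1) by blast
  have four: "y [^] (4::nat) = \<one>"
  proof (rule ccontr)
    assume "y [^] (4::nat) \<noteq> \<one>"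
    then have "\<not> 2 ^ m dvd (2 ^ 2 :: nat)"
      using m y(1) by (simp add: pow_eq_id)
    then have "m \<ge> 3"
      using le_imp_power_dvd[of m 2 "2 :: nat"] by (cases "m \<le> 2") auto
    define w where "w = y [^] (2 ^ (m - 2) :: nat)"
    have w: "w \<in> generate G {y}" "ord w = 4"
      using exists_order_four_power[OF y(1) m] \<open>m \<ge> 3\<close> by (auto simp: w_def)
    have yyi: "(y \<otimes> y) \<otimes> i = i \<otimes> (y \<otimes> y)"
    proof -
      have "i \<otimes> (y \<otimes> y) = z \<otimes> (y \<otimes> (i \<otimes> y))"
        using y i z_closed by (metis m_assoc m_closed)
      also have "\<dots> = (z \<otimes> z) \<otimes> (y \<otimes> (y \<otimes> i))"
        unfolding y(2) using y(1) i z_closed z_central[of y] by (metis m_assoc m_closed)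
      finally show ?thesis
        using z_square y(1) i by (simp add: m_assoc)
    qed
    \<comment> \<open>An order of at least 8 makes the exponent \<open>2^(m - 2)\<close> even, so
      \<open>w\<close> is a power of \<open>y^2\<close>, which commutes with
      \<open>i\<close>.\<close>
    have "w = (y \<otimes> y) [^] (2 ^ (m - 3) :: nat)"
    proof -
      have "m - 2 = Suc (m - 3)"
        using \<open>m \<ge> 3\<close> by simp
      then have "w = y [^] (2 * 2 ^ (m - 3) :: nat)"
        by (simp add: w_def)
      moreover have "y \<otimes> y = y [^] (2::nat)"
        using y(1) by (simp add: numeral_2_eq_2)
      ultimately show ?thesis
        using y(1) by (simp add: nat_pow_pow)
    qed
    then have "w \<in> centralizer i"
      using nat_pow_mem_subgroup[OF subgroup_centralizer[OF i(1)], of "y \<otimes> y"] yyi y(1)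
      by (simp add: centralizer_def)
    moreover have wG: "w \<in> carrier G"
      using y(1) by (simp add: w_def)
    then have "w [^] (4::nat) = \<one>"
      using pow_ord_eq_1[OF wG] unfolding w(2) by simp
    ultimately have "w \<in> generate G {i}"
      by (rule order_four_mem[OF i])
    then have "i \<in> generate G {w}"
      using generate_singleton_sym[OF i(1)] w i by simp
    then have "i \<in> generate G {y}"
      using generate_singleton_mono[OF y(1) w(1)] by blast
    then show False
      using commute_generate_singleton[OF y(1) y(1) HOL.refl] not_comm by simp
  qed
  have "y \<otimes> y \<noteq> \<one>"
    using square_eq_one[OF y(1)] not_comm z_central[OF i(1)] i by auto
  then show ?thesis
    using four square_eq_one[of "y \<otimes> y"] y(1) by (auto simp: numeral_eq_Suc m_assoc)
qed

text \<open>\<open>anticommute_square\<close> applies to \<open>y a\<close> as well as to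
  \<open>y\<close>, so \<open>(y a)^2 = z = y^2\<close>; cancelling \<open>y\<close> leaves
  \<open>a y a = y\<close>.\<close>

lemma anticommute_inverts:
  assumes i: "i \<in> carrier G" "ord i = 4" and y: "y \<in> carrier G" "i \<otimes> y = z \<otimes> (y \<otimes> i)"
    and a: "a \<in> centralizer i"
  shows "inv y \<otimes> a \<otimes> y = inv a"
proof -
  have aG: "a \<in> carrier G" and ai: "a \<otimes> i = i \<otimes> a"
    using a by (auto simp: centralizer_def)
  have "i \<otimes> (y \<otimes> a) = z \<otimes> ((y \<otimes> a) \<otimes> i)"
    using i y aG ai z_closed by (metis m_assoc m_closed)
  then have "(y \<otimes> a) \<otimes> (y \<otimes> a) = z"
    using anticommute_square[OF i, of "y \<otimes> a"] y aG by simp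
  then have "y \<otimes> (a \<otimes> y \<otimes> a) = y \<otimes> y"
    using anticommute_square[OF i y] y aG by (simp add: m_assoc)
  then have "a \<otimes> y \<otimes> a = y"
    using y aG by simp
  then have "a \<otimes> y = y \<otimes> inv a"
    using y aG by (simp add: inv_solve_right)
  then show ?thesis
    using y aG by (simp add: m_assoc inv_solve_left')
qed

lemma anticommute_mult:
  assumes G: "i \<in> carrier G" "y \<in> carrier G" "w \<in> carrier G"
    and "i \<otimes> y = z \<otimes> (y \<otimes> i)" "i \<otimes> w = z \<otimes> (w \<otimes> i)"
  shows "y \<otimes> w \<in> centralizer i"
proof -
  have "i \<otimes> (y \<otimes> w) = z \<otimes> (y \<otimes> (i \<otimes> w))"
    using assms z_closed by (metis m_assoc m_closed)
  also have "\<dots> = (z \<otimes> z) \<otimes> (y \<otimes> w \<otimes> i)"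
    unfolding assms(5) using G z_closed z_central[of y] by (metis m_assoc m_closed)
  finally show ?thesis
    using G z_square by (simp add: centralizer_def)
qed

text \<open>For each \<open>g\<close> the finite subgroup \<open><i, x, g>\<close> provides its own
  element \<open>j\<close>. Either \<open>i\<close> lies in \<open><j>\<close> and inherits the
  property, or \<open>i\<close> does not commute with \<open>j\<close>; this forces exponent 4 on
  all of \<open>G\<close>, so that \<open><j>\<close> is its own centralizer.\<close>

lemma exists_order_four_commute_mod_z_all:
  assumes ab: "a \<in> carrier G" "b \<in> carrier G" "a \<otimes> b \<noteq> b \<otimes> a"
  obtains i where "i \<in> carrier G" "ord i = 4" "\<And>g. g \<in> carrier G \<Longrightarrow> commute_mod_z i g"
proof -
  \<comment> \<open>Either \<open>x\<close> has order at least 8 and \<open>i\<close> is a power of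
    it, or no such element exists and \<open>x = i\<close>.\<close>
  obtain i x where i: "i \<in> carrier G" "ord i = 4" and x: "x \<in> carrier G" "i \<in> generate G {x}"
    and x_cases: "x [^] (4::nat) \<noteq> \<one> \<or> (\<forall>g \<in> carrier G. g [^] (4::nat) = \<one>)"
  proof (cases "\<forall>g \<in> carrier G. g [^] (4::nat) = \<one>")
    case True
    let ?H = "generate G {a, b}"
    have "subgroup ?H G" "finite ?H"
      using ab by (auto intro!: generate_is_subgroup locally_finite)
    then obtain i where i: "i \<in> ?H" "ord i = 4"
      using exists_order_four_commute_mod_z[of ?H a b] ab by (metis generate.incl insertCI)
    then have "i \<in> carrier G"
      using generate_incl[of "{a, b}"] ab by auto
    then show ?thesis
      using that[of i i] i True by (simp add: generate.incl)
  next
    case False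
    then obtain x where x: "x \<in> carrier G" "x [^] (4::nat) \<noteq> \<one>"
      by blast
    obtain m where m: "ord x = 2 ^ m"
      using order_power_two x(1) by blast
    have "m \<ge> 2"
    proof (rule ccontr)
      assume "\<not> m \<ge> 2"
      then have "m = 0 \<or> m = 1"
        by arith
      then have "ord x dvd 4"
        using m by auto
      then show False
        using x by (simp add: pow_eq_id)
    qed
    from exists_order_four_power[OF x(1) m this] show ?thesis
      using that x by (metis nat_pow_closed)
  qed
  have "commute_mod_z i g" if g: "g \<in> carrier G" for g
  proof (cases "i \<otimes> g = g \<otimes> i")
    case False
    let ?H = "generate G {i, x, g}"
    have H: "subgroup ?H G" "finite ?H" "i \<in> ?H" "x \<in> ?H" "g \<in> ?H"
      using i x g by (auto intro!: generate_is_subgroup locally_finite intro: generate.incl)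
    then obtain j where j: "j \<in> ?H" "ord j = 4" and jH: "\<And>h. h \<in> ?H \<Longrightarrow> commute_mod_z j h"
      using exists_order_four_commute_mod_z[OF _ _ _ _ False] by metis
    have jG: "j \<in> carrier G"
      using subgroup.mem_carrier[OF H(1) j(1)] .
    have cent: "h \<in> centralizer j \<longleftrightarrow> j \<otimes> h = h \<otimes> j" if "h \<in> carrier G" for h
      using that by (auto simp: centralizer_def)
    show ?thesis
    proof (cases "i \<in> centralizer j")
      case True
      then have "i \<in> generate G {j}"
        using order_four_mem[OF jG j(2)] i by (metis pow_ord_eq_1)
      then show ?thesis
        using commute_mod_z_generate[OF jG g] jH[OF H(5)] by blast
    next
      case i_not: False
      have "x \<notin> centralizer j"
        using commute_generate_singleton[OF x(1) jG _ x(2)] i_not i(1) x(1)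
        by (auto simp: centralizer_def)
      then have "x \<otimes> x = z"
        using anticommute_square[OF jG j(2) x(1)] jH[OF H(4)] cent[OF x(1)]
        by (auto simp: commute_mod_z_def)
      then have "x [^] (4::nat) = \<one>"
        using x(1) z_square by (simp add: numeral_eq_Suc m_assoc) (metis m_assoc m_closed)
      \<comment> \<open>By \<open>x_cases\<close>, \<open>x^4 = 1\<close> is possible only if every
        fourth power is trivial.\<close>
      then have exp4: "h [^] (4::nat) = \<one>" if "h \<in> carrier G" for h
        using x_cases that by blast
      have ji: "j \<otimes> i = z \<otimes> (i \<otimes> j)"
        using i_not jH[OF H(3)] cent[OF i(1)] by (auto simp: commute_mod_z_def)
      have cmz_cent: "commute_mod_z i h" if "h \<in> centralizer j" for h
      proof -
        have "h \<in> generate G {j}"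
          using order_four_mem[OF jG j(2) that] that exp4 by (simp add: centralizer_def)
        then have "commute_mod_z h i"
          using commute_mod_z_generate[OF jG i(1)] jH[OF H(3)] by blast
        then show ?thesis
          using that i(1) by (auto simp: centralizer_def dest: commute_mod_z_sym)
      qed
      show ?thesis
      proof (cases "g \<in> centralizer j")
        case False
        then have "j \<otimes> g = z \<otimes> (g \<otimes> j)"
          using jH[OF H(5)] cent[OF g] by (auto simp: commute_mod_z_def)
        \<comment> \<open>Both \<open>i\<close> and \<open>g\<close> pick up a factor
          \<open>z\<close> when passing \<open>j\<close>, so \<open>i g\<close> centralizes
          \<open>j\<close>. Commuting with \<open>i g\<close> modulo \<open>z\<close> then gives the
          same for \<open>g\<close> by cancelling \<open>i\<close>.\<close>
        then have "commute_mod_z i (i \<otimes> g)"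
          using cmz_cent anticommute_mult[OF jG i(1) g ji] by blast
        moreover have "z \<otimes> (i \<otimes> g \<otimes> i) = i \<otimes> (z \<otimes> (g \<otimes> i))"
          using i(1) g z_closed z_central[OF i(1)] by (metis m_assoc m_closed)
        ultimately show ?thesis
          using i(1) g z_closed by (auto simp: commute_mod_z_def m_assoc)
      qed (use cmz_cent in blast)
    qed
  qed (simp add: commute_mod_z_def)
  then show ?thesis
    using that i by blast
qed

text \<open>The centralizer of \<open>i\<close> is abelian, so some \<open>y\<close> lies outside.
  Elements outside pass \<open>i\<close> at the cost of one \<open>z\<close>, hence the product of
  two of them is inside; this encodes index 2.\<close>

lemma index_two_inverted_centralizer:
  assumes ab: "a \<in> carrier G" "b \<in> carrier G" "a \<otimes> b \<noteq> b \<otimes> a"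
  obtains i y where "i \<in> carrier G" "ord i = 4" "y \<in> carrier G" "y \<notin> centralizer i" "y \<otimes> y = z"
    "\<And>c. c \<in> centralizer i \<Longrightarrow> inv y \<otimes> c \<otimes> y = inv c"
    "\<And>g. g \<in> carrier G \<Longrightarrow> g \<notin> centralizer i \<Longrightarrow> g \<otimes> y \<in> centralizer i"
proof -
  obtain i where i: "i \<in> carrier G" "ord i = 4" and comm: "\<And>g. g \<in> carrier G \<Longrightarrow> commute_mod_z i g"
    using exists_order_four_commute_mod_z_all[OF ab] by blast
  have anti: "i \<otimes> g = z \<otimes> (g \<otimes> i)" if "g \<in> carrier G" "g \<notin> centralizer i" for g
    using comm[OF that(1)] that by (auto simp: commute_mod_z_def centralizer_def)
  have "\<exists>y \<in> carrier G. y \<notin> centralizer i"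
  proof (rule ccontr)
    assume "\<not> ?thesis"
    then show False
      using commute_if_one_cyclic[OF subgroup_centralizer[OF i(1)], of a b]
        order_four_centralizer[OF i] ab p_eq_2 by auto
  qed
  then obtain y where y: "y \<in> carrier G" "y \<notin> centralizer i"
    by blast
  show ?thesis
    using that[OF i y anticommute_square[OF i y(1) anti[OF y]]] anticommute_inverts[OF i y(1) anti[OF y]]
      anticommute_mult[OF i(1) _ y(1) anti anti[OF y]] by blast
qed

end

section \<open>The Pruefer 2-group\<close>

text \<open>A compatible choice of generators in an ascending union of cyclic groups of order
  \<open>2^n\<close>; it determines the group up to isomorphism.\<close>

definition pruefer_chain :: "('a, 'b) monoid_scheme \<Rightarrow> (nat \<Rightarrow> 'a) \<Rightarrow> bool" where
  "pruefer_chain G x \<longleftrightarrow>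
     (\<forall>n. x n \<in> carrier G \<and> group.ord G (x n) = 2 ^ n \<and> x (Suc n) [^]\<^bsub>G\<^esub> (2::nat) = x n) \<and>
     (\<forall>a \<in> carrier G. \<exists>n. \<exists>k::nat. a = x n [^]\<^bsub>G\<^esub> k)"

context group
begin

lemma pruefer_chain_shift:
  assumes "pruefer_chain G x"
  shows "x n [^] (k::nat) = x (n + m) [^] (2 ^ m * k)"
proof (induction m)
  case (Suc m)
  have G: "x (Suc (n + m)) \<in> carrier G" and sq: "x (n + m) = x (Suc (n + m)) [^] (2::nat)"
    using assms by (auto simp: pruefer_chain_def)
  show ?case
    unfolding Suc sq using G by (simp add: nat_pow_pow mult.assoc)
qed simp

text \<open>Both powers are moved to the common level \<open>n + m\<close>. The resulting criterion
  does not mention the group, so any two chains satisfy the same relations.\<close>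

lemma pruefer_chain_pow_eq_iff:
  assumes "pruefer_chain G x"
  shows "x n [^] (k::nat) = x m [^] (l::nat) \<longleftrightarrow>
    (2::int) ^ (n + m) dvd 2 ^ n * int l - 2 ^ m * int k"
proof -
  have "x n [^] k = x (n + m) [^] (2 ^ m * k)" "x m [^] l = x (n + m) [^] (2 ^ n * l)"
    using pruefer_chain_shift[OF assms, of n k m] pruefer_chain_shift[OF assms, of m l n]
    by (simp_all add: add.commute)
  moreover have "x (n + m) \<in> carrier G" "ord (x (n + m)) = 2 ^ (n + m)"
    using assms by (auto simp: pruefer_chain_def)
  ultimately show ?thesis
    using int_pow_eq[of "x (n + m)" "int (2 ^ m * k)" "int (2 ^ n * l)", unfolded int_pow_int]
    by simp
qed

lemma pruefer_chain_common_level: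
  assumes x: "pruefer_chain G x" and "a \<in> carrier G" "b \<in> carrier G"
  obtains n and k l :: nat where "a = x n [^] k" "b = x n [^] l"
proof -
  obtain n m and k l :: nat where "a = x n [^] k" "b = x m [^] l"
    using assms by (auto simp: pruefer_chain_def) metis
  then show ?thesis
    using pruefer_chain_shift[OF x, of n k m] pruefer_chain_shift[OF x, of m l n] that
    by (metis add.commute)
qed

lemma iso_if_pruefer_chain:
  assumes H: "group H" and x: "pruefer_chain G x" and r: "pruefer_chain H r"
  shows "G \<cong> H"
proof -
  interpret H: group H
    by (rule H)
  have eq_iff: "r n [^]\<^bsub>H\<^esub> (k::nat) = r m [^]\<^bsub>H\<^esub> (l::nat) \<longleftrightarrow> x n [^] k = x m [^] l" for n m k l
    using pruefer_chain_pow_eq_iff[OF x] H.pruefer_chain_pow_eq_iff[OF r] by metis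
  have xG: "x n \<in> carrier G" and rH: "r n \<in> carrier H" for n
    using x r by (auto simp: pruefer_chain_def)
  \<comment> \<open>The value does not depend on the chosen \<open>n\<close> and \<open>k\<close>,
    by \<open>eq_iff\<close>.\<close>
  define h where "h a = (SOME w. \<exists>n. \<exists>k::nat. a = x n [^] k \<and> w = r n [^]\<^bsub>H\<^esub> k)" for a
  have h: "h (x n [^] k) = r n [^]\<^bsub>H\<^esub> k" for n and k :: nat
    unfolding h_def by (rule someI2[where a = "r n [^]\<^bsub>H\<^esub> k"]) (use eq_iff in metis)+
  have "h \<in> hom G H"
  proof (rule homI)
    fix a assume "a \<in> carrier G"
    then show "h a \<in> carrier H"
      using x h rH by (auto simp: pruefer_chain_def)
  next
    fix a b assume "a \<in> carrier G" "b \<in> carrier G"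
    then obtain n and k l :: nat where ab: "a = x n [^] k" "b = x n [^] l"
      using pruefer_chain_common_level[OF x] by metis
    then have "a \<otimes> b = x n [^] (k + l)"
      using xG by (simp add: nat_pow_mult)
    then show "h (a \<otimes> b) = h a \<otimes>\<^bsub>H\<^esub> h b"
      using ab h rH by (simp add: H.nat_pow_mult)
  qed
  moreover have "inj_on h (carrier G)"
  proof (rule inj_onI)
    fix a b assume "a \<in> carrier G" "b \<in> carrier G" "h a = h b"
    moreover from this obtain n and k l :: nat where "a = x n [^] k" "b = x n [^] l"
      using pruefer_chain_common_level[OF x] by metis
    ultimately show "a = b"
      using h eq_iff by metis
  qed
  moreover have "h c \<in> carrier H" if "c \<in> carrier G" for c
    using calculation(1) that by (rule hom_in_carrier)
  moreover have "c \<in> h ` carrier G" if c: "c \<in> carrier H" for c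
  proof -
    obtain n and k :: nat where "c = r n [^]\<^bsub>H\<^esub> k"
      using r c by (auto simp: pruefer_chain_def)
    then have "c = h (x n [^] k)"
      by (simp add: h)
    then show ?thesis
      using xG by blast
  qed
  ultimately have "h \<in> iso G H"
    by (auto simp: iso_def bij_betw_def)
  then show ?thesis
    by (rule is_isoI)
qed

end

lemma group_pruefer_2_group: "group pruefer_2_group"
proof (rule groupI)
  fix x y assume "x \<in> carrier pruefer_2_group" "y \<in> carrier pruefer_2_group"
  then obtain k l :: nat where kl: "x ^ (2 ^ k) = 1" "y ^ (2 ^ l) = 1"
    by (auto simp: pruefer_2_group_def)
  have "(x * y) ^ (2 ^ (k + l)) = (x ^ (2 ^ k)) ^ (2 ^ l) * (y ^ (2 ^ l)) ^ (2 ^ k)"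
    by (simp add: power_mult_distrib power_add mult.commute flip: power_mult)
  then show "x \<otimes>\<^bsub>pruefer_2_group\<^esub> y \<in> carrier pruefer_2_group"
    using kl by (auto simp: pruefer_2_group_def)
next
  fix x assume "x \<in> carrier pruefer_2_group"
  then obtain k where k: "x ^ (2 ^ k) = 1"
    by (auto simp: pruefer_2_group_def)
  then have "x \<noteq> 0"
    by (auto simp: power_0_left)
  moreover have "inverse x ^ (2 ^ k) = 1"
    using k by (simp add: power_inverse)
  ultimately show "\<exists>y \<in> carrier pruefer_2_group. y \<otimes>\<^bsub>pruefer_2_group\<^esub> x = \<one>\<^bsub>pruefer_2_group\<^esub>"
    by (auto simp: pruefer_2_group_def intro!: exI[of _ "inverse x"])
qed (auto simp: pruefer_2_group_def mult.assoc)

lemma pow_pruefer_2_group: "z [^]\<^bsub>pruefer_2_group\<^esub> (n::nat) = z ^ n"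
proof -
  interpret group pruefer_2_group
    by (rule group_pruefer_2_group)
  show ?thesis
    by (induction n) (auto simp: pruefer_2_group_def)
qed

lemma pruefer_chain_pruefer_2_group:
  "pruefer_chain pruefer_2_group (\<lambda>n. cis (2 * pi / 2 ^ n))"
proof -
  interpret group pruefer_2_group
    by (rule group_pruefer_2_group)
  let ?r = "\<lambda>n. cis (2 * pi / 2 ^ n)"
  have pow: "?r n ^ k = cis (2 * pi * real k / real (2 ^ n))" for n k
    by (simp add: DeMoivre mult_ac)
  have one: "?r n ^ (2 ^ n) = 1" for n
    unfolding pow by simp
  have mem: "?r n \<in> carrier pruefer_2_group" for n
    using one by (auto simp: pruefer_2_group_def)
  have ord: "ord (?r n) = 2 ^ n" for n
    unfolding ord_unique[OF mem]
  proof
    fix k :: nat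
    have bij: "bij_betw (\<lambda>k. cis (2 * pi * real k / real (2 ^ n))) {..<2 ^ n} {z. z ^ (2 ^ n) = 1}"
      by (rule bij_betw_roots_unity) simp
    \<comment> \<open>The bijection with the roots of unity covers exponents below
      \<open>2^n\<close>, so \<open>k\<close> is reduced before it is applied.\<close>
    have "?r n ^ k = ?r n ^ (k mod 2 ^ n)"
    proof -
      have "?r n ^ k = (?r n ^ (2 ^ n)) ^ (k div 2 ^ n) * ?r n ^ (k mod 2 ^ n)"
        by (simp only: flip: power_mult power_add) simp
      then show ?thesis
        by (simp only: one) simp
    qed
    also have "\<dots> = 1 \<longleftrightarrow> k mod 2 ^ n = 0"
      using inj_onD[OF bij_betw_imp_inj_on[OF bij], of "k mod 2 ^ n" 0] unfolding pow by auto
    finally show "?r n [^]\<^bsub>pruefer_2_group\<^esub> k = \<one>\<^bsub>pruefer_2_group\<^esub> \<longleftrightarrow> 2 ^ n dvd k"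
      unfolding pow_pruefer_2_group by (simp add: pruefer_2_group_def dvd_eq_mod_eq_0)
  qed
  have "\<exists>n k. a = ?r n ^ k" if a: "a \<in> carrier pruefer_2_group" for a
  proof -
    obtain n where "a \<in> {z. z ^ (2 ^ n) = 1}"
      using a by (auto simp: pruefer_2_group_def)
    then obtain k where "a = cis (2 * pi * real k / real (2 ^ n))"
      using bij_betw_imp_surj_on[OF bij_betw_roots_unity[of "2 ^ n"]] by auto
    then show ?thesis
      unfolding pow by blast
  qed
  moreover have "?r (Suc n) ^ 2 = ?r n" for n
    unfolding pow by (simp add: field_simps)
  ultimately show ?thesis
    unfolding pruefer_chain_def pow_pruefer_2_group using mem ord by blast
qed

section \<open>Quaternion groups\<close>

fun letter_value :: "('a, 'b) monoid_scheme \<Rightarrow> ('g \<Rightarrow> 'a) \<Rightarrow> 'g \<times> bool \<Rightarrow> 'a" where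
  "letter_value G f (g, b) = (if b then inv\<^bsub>G\<^esub> f g else f g)"

primrec word_value :: "('a, 'b) monoid_scheme \<Rightarrow> ('g \<Rightarrow> 'a) \<Rightarrow> 'g word \<Rightarrow> 'a" where
  "word_value G f [] = \<one>\<^bsub>G\<^esub>"
| "word_value G f (l # w) = letter_value G f l \<otimes>\<^bsub>G\<^esub> word_value G f w"

context group
begin

lemma letter_value_closed: "range f \<subseteq> carrier G \<Longrightarrow> letter_value G f l \<in> carrier G"
  by (cases l) auto

lemma word_value_closed: "range f \<subseteq> carrier G \<Longrightarrow> word_value G f w \<in> carrier G"
  by (induction w) (auto intro: letter_value_closed)

lemma word_value_append:
  "range f \<subseteq> carrier G \<Longrightarrow> word_value G f (u @ v) = word_value G f u \<otimes> word_value G f v"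
  by (induction u) (simp_all add: word_value_closed letter_value_closed m_assoc)

lemma word_value_replicate:
  assumes "range f \<subseteq> carrier G"
  shows "word_value G f (replicate n (g, False)) = f g [^] n"
proof (induction n)
  case (Suc n)
  have "f g \<in> carrier G"
    using assms by blast
  then show ?case
    using Suc nat_pow_Suc2[of "f g" n] by simp
qed simp

lemma word_value_pres_eq:
  assumes f: "range f \<subseteq> carrier G"
    and R: "\<And>u v. (u, v) \<in> R \<Longrightarrow> word_value G f u = word_value G f v"
    and "pres_eq R u v"
  shows "word_value G f u = word_value G f v"
  using assms(3)
proof induction
  case (cancel g b)
  then show ?case
    using f by (auto simp: image_subset_iff)
qed (simp_all add: R word_value_append f)

text \<open>This is von Dyck's theorem: evaluation of words is invariant under
  \<open>pres_eq\<close>, so any representative of a class may be used.\<close>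

lemma presented_group_hom:
  assumes f: "range f \<subseteq> carrier G"
    and R: "\<And>u v. (u, v) \<in> R \<Longrightarrow> word_value G f u = word_value G f v"
  obtains h where "h \<in> hom (presented_group R) G" "\<And>w. h (pres_class R w) = word_value G f w"
proof -
  define h where "h X = word_value G f (SOME w. w \<in> X)" for X
  have h: "h (pres_class R w) = word_value G f w" for w
  proof -
    have "(SOME v. v \<in> pres_class R w) \<in> pres_class R w"
      by (rule someI[of _ w]) (simp add: pres_class_def pres_eq.refl)
    then have "pres_eq R w (SOME v. v \<in> pres_class R w)"
      by (simp add: pres_class_def)
    then show ?thesis
      using word_value_pres_eq[OF f R] by (simp add: h_def)
  qed
  have "h \<in> hom (presented_group R) G"
  proof (rule homI)
    fix X assume "X \<in> carrier (presented_group R)"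
    then show "h X \<in> carrier G"
      using h word_value_closed[OF f] by (auto simp: presented_group_def)
  next
    fix X Y assume "X \<in> carrier (presented_group R)" "Y \<in> carrier (presented_group R)"
    then obtain u v where "X = pres_class R u" "Y = pres_class R v"
      by (auto simp: presented_group_def)
    then show "h (X \<otimes>\<^bsub>presented_group R\<^esub> Y) = h X \<otimes> h Y"
      using h word_value_append[OF f] by (simp add: presented_group_mult)
  qed
  then show ?thesis
    using that h by blast
qed

text \<open>The rule \<open>y b = b^(-1) y\<close> moves every \<open>y\<close> to the right, and
  \<open>y y\<close> falls back into \<open>A\<close>. In the presented quaternion group this yields
  the normal form \<open>X^k\<close> or \<open>X^k Y\<close>.\<close>

lemma subgroup_inverted_extension:
  assumes A: "subgroup A G" and y: "y \<in> carrier G" "y \<otimes> y \<in> A"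
    and inverts: "\<And>a. a \<in> A \<Longrightarrow> inv y \<otimes> a \<otimes> y = inv a"
  shows "subgroup (A \<union> (A #> y)) G"
proof -
  have AG: "a \<in> carrier G" if "a \<in> A" for a
    using A that by (rule subgroup.mem_carrier)
  have swap: "y \<otimes> b = inv b \<otimes> y" if "b \<in> A" for b
  proof -
    have "inv b \<in> A"
      using A that by (rule subgroup.m_inv_closed)
    from inverts[OF this] have "inv y \<otimes> (inv b \<otimes> y) = b"
      using AG that y(1) by (simp add: m_assoc)
    then show ?thesis
      using AG that y(1) by (metis inv_closed inv_solve_left m_closed)
  qed
  have mult: "g \<otimes> h \<in> A \<union> (A #> y)" if gh: "g \<in> A \<union> (A #> y)" "h \<in> A \<union> (A #> y)" for g h
  proof -
    obtain a where a: "a \<in> A" "g = a \<or> g = a \<otimes> y"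
      using gh(1) by (auto simp: r_coset_def)
    obtain b where b: "b \<in> A" "h = b \<or> h = b \<otimes> y"
      using gh(2) by (auto simp: r_coset_def)
    have ab: "a \<otimes> b \<in> A" "a \<otimes> inv b \<in> A" "a \<otimes> inv b \<otimes> (y \<otimes> y) \<in> A"
      using A a b y by (auto simp: subgroup.m_closed subgroup.m_inv_closed)
    have "a \<otimes> (b \<otimes> y) = (a \<otimes> b) \<otimes> y" "a \<otimes> y \<otimes> b = (a \<otimes> inv b) \<otimes> y"
      "a \<otimes> y \<otimes> (b \<otimes> y) = a \<otimes> inv b \<otimes> (y \<otimes> y)"
      using a(1) b(1) AG y(1) swap[OF b(1)] by (simp_all add: m_assoc) (simp add: swap flip: m_assoc)
    then show ?thesis
      using a(2) b(2) ab by (auto simp: r_coset_def)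
  qed
  show ?thesis
  proof (rule subgroupI)
    show "A \<union> (A #> y) \<subseteq> carrier G"
      using AG y(1) by (auto simp: r_coset_def)
    show "A \<union> (A #> y) \<noteq> {}"
      using subgroup.one_closed[OF A] by blast
    fix g assume g: "g \<in> A \<union> (A #> y)"
    show "inv g \<in> A \<union> (A #> y)"
    proof (cases "g \<in> A")
      case False
      then obtain a where a: "a \<in> A" "g = a \<otimes> y"
        using g by (auto simp: r_coset_def)
      have gG: "g \<in> carrier G"
        using a AG y(1) by simp
      \<comment> \<open>All elements of the coset share the square of \<open>y\<close>, which lies
        in \<open>A\<close>; this produces the inverse of \<open>g\<close>.\<close>
      have "g \<otimes> g = y \<otimes> y"
        using a AG y(1) swap[OF a(1)] by (simp add: m_assoc) (simp flip: m_assoc)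
      then have "g \<otimes> (g \<otimes> inv (y \<otimes> y)) = \<one>"
        using gG y(1) by (simp flip: m_assoc)
      then have "inv g = g \<otimes> inv (y \<otimes> y)"
        using gG y(1) by (metis inv_closed inv_equality m_closed inv_comm)
      then show ?thesis
        using mult[OF g] subgroup.m_inv_closed[OF A y(2)] by simp
    qed (use subgroup.m_inv_closed[OF A] in blast)
  qed (rule mult)
qed

text \<open>Conjugation is multiplicative, and so is inversion on the abelian group
  \<open><x>\<close>, so agreement at \<open>x\<close> spreads to all of it.\<close>

lemma inverts_generate_singleton:
  assumes x: "x \<in> carrier G" and y: "y \<in> carrier G" and inverts: "inv y \<otimes> x \<otimes> y = inv x"
    and a: "a \<in> generate G {x}"
  shows "inv y \<otimes> a \<otimes> y = inv a"
  using a
proof induction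
  case (inv h)
  have "inv (inv y \<otimes> x \<otimes> y) = x"
    using x inverts by simp
  then show ?case
    using inv x y by (simp add: inv_mult_group m_assoc)
next
  case (eng a b)
  have G: "a \<in> carrier G" "b \<in> carrier G"
    using eng generate_in_carrier[of "{x}"] x by auto
  have "a \<otimes> x = x \<otimes> a"
    using commute_generate_singleton[OF x x HOL.refl eng(1)] .
  then have "b \<otimes> a = a \<otimes> b"
    using commute_generate_singleton[OF x G(1) _ eng(2)] by simp
  moreover have "inv y \<otimes> (a \<otimes> b) \<otimes> y = (inv y \<otimes> a \<otimes> y) \<otimes> (inv y \<otimes> b \<otimes> y)"
  proof -
    have "y \<otimes> (inv y \<otimes> (b \<otimes> y)) = b \<otimes> y"
      using G y by (simp flip: m_assoc)
    then show ?thesis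
      using G y by (simp add: m_assoc)
  qed
  ultimately show ?case
    using eng G by (metis inv_mult_group)
qed (use assms in auto)

end

lemma carrier_presented_group_generate:
  "carrier (presented_group R) =
    generate (presented_group R) (range (\<lambda>g. pres_class R [(g, False)]))"
proof -
  interpret Q: group "presented_group R"
    by (rule group_presented_group)
  let ?f = "\<lambda>g. pres_class R [(g, False)]"
  let ?X = "generate (presented_group R) (range ?f)"
  have f: "range ?f \<subseteq> carrier (presented_group R)"
    by (auto simp: presented_group_def)
  then have X: "subgroup ?X (presented_group R)"
    by (rule Q.generate_is_subgroup)
  have one: "pres_class R [] = \<one>\<^bsub>presented_group R\<^esub>"
    by (simp add: presented_group_def)
  have letter: "pres_class R [(g, b)] \<in> ?X" for g b
  proof (cases b)
    case True
    have "pres_class R [(g, True)] \<otimes>\<^bsub>presented_group R\<^esub> ?f g = \<one>\<^bsub>presented_group R\<^esub>"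
      using pres_eq.cancel[of R g True] by (simp add: presented_group_mult pres_class_eq_iff flip: one)
    then have "pres_class R [(g, True)] = inv\<^bsub>presented_group R\<^esub> ?f g"
      using f by (intro Q.inv_equality[symmetric]) (auto simp: presented_group_def)
    then show ?thesis
      using True by (simp add: generate.inv)
  qed (simp add: generate.incl)
  have "pres_class R w \<in> ?X" for w
  proof (induction w)
    case (Cons l w)
    obtain g b where "l = (g, b)"
      by force
    then show ?case
      using subgroup.m_closed[OF X letter Cons] by (simp add: presented_group_mult)
  qed (simp add: one generate.one)
  then show ?thesis
    using Q.generate_incl[OF f] by (auto simp: presented_group_def)
qed

text \<open>The relations give a homomorphism from the presented group onto \<open>G\<close>. Its
  kernel is read off from the normal form, so the order of the presented group never has to be
  computed.\<close>

lemma (in group) iso_quaternion_group: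
  assumes x: "x \<in> carrier G" "ord x = 2 ^ (n - 1)" and y: "y \<in> carrier G"
    and relations: "y \<otimes> y = x [^] (2 ^ (n - 2) :: nat)" "inv y \<otimes> x \<otimes> y = inv x"
    and "y \<notin> generate G {x}" and gen: "carrier G = generate G {x, y}"
  shows "G \<cong> quaternion_group n"
proof -
  let ?R = "quaternion_relations n"
  let ?Q = "presented_group ?R"
  interpret Q: group ?Q
    by (rule group_presented_group)
  define f where "f = (\<lambda>g. case g of GenX \<Rightarrow> x | GenY \<Rightarrow> y)"
  have f: "range f \<subseteq> carrier G" "f GenX = x" "f GenY = y"
    using x y by (auto simp: f_def split: quaternion_gen.splits)
  have "x [^] (2 ^ (n - Suc 0) :: nat) = \<one>"
    using pow_ord_eq_1[OF x(1)] unfolding x(2) by simp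
  then have R: "word_value G f u = word_value G f v" if "(u, v) \<in> ?R" for u v
    using that x y relations word_value_replicate[OF f(1), of _ GenX]
    by (auto simp: quaternion_relations_def f(2,3) m_assoc)
  obtain h where h: "h \<in> hom ?Q G" and h_class: "\<And>w. h (pres_class ?R w) = word_value G f w"
    using presented_group_hom[OF f(1) R] by blast
  interpret h: group_hom ?Q G h
    by (intro group_hom.intro group_hom_axioms.intro h Q.is_group is_group)
  define X where "X = pres_class ?R [(GenX, False)]"
  define Y where "Y = pres_class ?R [(GenY, False)]"
  have XY: "X \<in> carrier ?Q" "Y \<in> carrier ?Q"
    by (auto simp: X_def Y_def presented_group_def)
  have hXY: "h X = x" "h Y = y"
    using x y by (simp_all add: X_def Y_def h_class f)
  have one: "pres_class ?R [] = \<one>\<^bsub>?Q\<^esub>"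
    by (simp add: presented_group_def)
  have X_pow: "X [^]\<^bsub>?Q\<^esub> k = pres_class ?R (replicate k (GenX, False))" for k :: nat
    by (induction k)
      (simp_all add: one X_def presented_group_mult replicate_append_same flip: replicate_Suc)
  have class_eq: "pres_class ?R u = pres_class ?R v" if "(u, v) \<in> ?R" for u v
    using that pres_eq.rel by (simp add: pres_class_eq_iff)
  have X_ord: "X [^]\<^bsub>?Q\<^esub> (2 ^ (n - 1) :: nat) = \<one>\<^bsub>?Q\<^esub>"
    unfolding X_pow one[symmetric] by (rule class_eq) (simp add: quaternion_relations_def)
  have Y_square: "Y \<otimes>\<^bsub>?Q\<^esub> Y = X [^]\<^bsub>?Q\<^esub> (2 ^ (n - 2) :: nat)"
    unfolding X_pow Y_def presented_group_mult
    by (rule class_eq) (simp add: quaternion_relations_def)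
  have inverse_letter: "inv\<^bsub>?Q\<^esub> pres_class ?R [(g, False)] = pres_class ?R [(g, True)]" for g
    using pres_eq.cancel[of ?R g True]
    by (intro Q.inv_equality)
      (auto simp: presented_group_mult pres_class_eq_iff simp flip: one, auto simp: presented_group_def)
  have conj: "inv\<^bsub>?Q\<^esub> Y \<otimes>\<^bsub>?Q\<^esub> X \<otimes>\<^bsub>?Q\<^esub> Y = inv\<^bsub>?Q\<^esub> X"
    unfolding X_def Y_def inverse_letter presented_group_mult
    by (rule class_eq) (simp add: quaternion_relations_def)
  let ?A = "generate ?Q {X}"
  have A: "subgroup ?A ?Q"
    using XY by (simp add: Q.generate_is_subgroup)
  have "Q.ord X \<noteq> 0"
    using X_ord XY(1) Q.ord_eq_0 by force
  then have A_iff: "q \<in> ?A \<longleftrightarrow> (\<exists>k::nat. q = X [^]\<^bsub>?Q\<^esub> k)" for q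
    using Q.mem_generate_singleton_iff XY(1) by blast
  have "subgroup (?A \<union> (?A #>\<^bsub>?Q\<^esub> Y)) ?Q"
    using Q.subgroup_inverted_extension[OF A XY(2)] Y_square A_iff
      Q.inverts_generate_singleton[OF XY conj] by blast
  moreover have "range (\<lambda>g. pres_class ?R [(g, False)]) \<subseteq> ?A \<union> (?A #>\<^bsub>?Q\<^esub> Y)"
  proof -
    have "X \<in> ?A"
      by (simp add: generate.incl)
    moreover have "Y \<in> ?A #>\<^bsub>?Q\<^esub> Y"
      using Q.rcos_self[OF XY(2) A] .
    ultimately have "pres_class ?R [(g, False)] \<in> ?A \<union> (?A #>\<^bsub>?Q\<^esub> Y)" for g
      by (cases g) (simp_all flip: X_def Y_def)
    then show ?thesis
      by blast
  qed
  ultimately have normal_form: "carrier ?Q \<subseteq> ?A \<union> (?A #>\<^bsub>?Q\<^esub> Y)"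
    unfolding carrier_presented_group_generate by (intro Q.generate_subgroup_incl)
  have hA: "h q \<in> generate G {x}" if "q \<in> ?A" for q
  proof -
    obtain k where "q = X [^]\<^bsub>?Q\<^esub> (k::nat)"
      using \<open>q \<in> ?A\<close> A_iff by blast
    then have "h q = x [^] k"
      using h.hom_nat_pow XY(1) hXY(1) by simp
    then show ?thesis
      using nat_pow_mem_subgroup[OF generate_is_subgroup, of "{x}" x k] x(1) by (simp add: generate.incl)
  qed
  have "q = \<one>\<^bsub>?Q\<^esub>" if q: "q \<in> carrier ?Q" "h q = \<one>" for q
  proof (cases "q \<in> ?A")
    case True
    then obtain k where k: "q = X [^]\<^bsub>?Q\<^esub> (k::nat)"
      using A_iff by blast
    then have "x [^] k = \<one>"
      using h.hom_nat_pow XY(1) hXY(1) q(2) by simp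
    then have "2 ^ (n - 1) dvd k"
      using x by (simp add: pow_eq_id)
    then show ?thesis
      using k X_ord XY(1) by (metis Q.nat_pow_one Q.nat_pow_pow dvdE)
  next
    case False
    then obtain c where c: "c \<in> ?A" "q = c \<otimes>\<^bsub>?Q\<^esub> Y"
      using q(1) normal_form by (auto simp: r_coset_def)
    have cQ: "c \<in> carrier ?Q"
      using subgroup.mem_carrier[OF A c(1)] .
    \<comment> \<open>A kernel element in the coset of \<open>Y\<close> would put \<open>y\<close>
      into \<open><x>\<close>.\<close>
    have "h c \<otimes> y = \<one>"
      using c(2) q(2) cQ XY(2) hXY(2) by simp
    then have "y = inv (h c)"
      using cQ y by (metis h.hom_closed inv_equality inv_inv m_closed)
    moreover have "inv (h c) \<in> generate G {x}"
      using subgroup.m_inv_closed[OF generate_is_subgroup hA[OF c(1)]] x(1) by simp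
    ultimately show ?thesis
      using assms by simp
  qed
  moreover have "carrier G \<subseteq> h ` carrier ?Q"
  proof -
    have "subgroup (h ` carrier ?Q) G"
      by (rule h.img_is_subgroup)
    moreover have "{x, y} \<subseteq> h ` carrier ?Q"
      using XY hXY by force
    ultimately show ?thesis
      unfolding gen by (intro generate_subgroup_incl)
  qed
  ultimately have "h \<in> iso ?Q G"
    unfolding h.iso_iff by blast
  then show ?thesis
    unfolding quaternion_group_def using Q.iso_sym is_isoI by blast
qed

section \<open>Identification of the group\<close>

context unique_involution_group
begin

text \<open>Dependent choice needs a square root in \<open>A\<close> of a given \<open>x\<close> of
  order \<open>2^n\<close>: for any \<open>w\<close> of order \<open>2^(n+1)\<close>, uniqueness
  gives \<open>x = (w^2)^j\<close>, and \<open>w^j\<close> is the root.\<close>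

lemma exists_pruefer_chain:
  assumes A: "subgroup A G" and level: "\<And>k. one_cyclic_of_order A (2 ^ k)"
    and unbounded: "\<And>n. \<exists>a \<in> A. ord a = 2 ^ n"
  obtains x where "pruefer_chain (subgroup_generated G A) x"
proof -
  have AG: "a \<in> carrier G" if "a \<in> A" for a
    using A that by (rule subgroup.mem_carrier)
  have "\<exists>x. \<forall>n. (x n \<in> A \<and> ord (x n) = 2 ^ n) \<and> x (Suc n) [^] (2::nat) = x n"
  proof (rule dependent_nat_choice)
    show "\<exists>x. x \<in> A \<and> ord x = 2 ^ 0"
      using unbounded[of 0] by blast
    fix x n assume x: "x \<in> A \<and> ord x = 2 ^ n"
    obtain w where w: "w \<in> A" "ord w = 2 ^ Suc n"
      using unbounded by blast
    have w2: "ord (w [^] (2::nat)) = 2 ^ n" "w [^] (2::nat) \<in> A"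
      using ord_pow_prime_power[of w "Suc n" 1] w AG p_eq_2 nat_pow_mem_subgroup[OF A] by auto
    show "\<exists>y. (y \<in> A \<and> ord y = 2 ^ Suc n) \<and> y [^] (2::nat) = x"
    proof (cases n)
      \<comment> \<open>For \<open>x = 1\<close> the root \<open>w^j\<close> might be trivial, so
        \<open>w\<close> itself is taken.\<close>
      case 0
      then have "w [^] (2::nat) = x"
        using w2 x AG by (metis ord_eq_1 power_0)
      then show ?thesis
        using w by blast
    next
      case (Suc m)
      have "x \<in> generate G {w [^] (2::nat)}"
        using one_cyclic_of_orderD[OF level w2(2) _ w2(1)] x by blast
      then obtain j where j: "x = (w [^] (2::nat)) [^] (j::nat)"
        using mem_generate_singleton_iff[OF AG[OF w2(2)] ord_nonzero[OF AG[OF w2(2)]]] by blast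
      define v where "v = w [^] j"
      have v: "v \<in> A" "v [^] (2::nat) = x"
        using j w AG nat_pow_mem_subgroup[OF A] by (auto simp: v_def nat_pow_pow mult.commute)
      obtain l where l: "ord v = 2 ^ l"
        using order_power_two AG v(1) by blast
      have "l \<noteq> 0"
      proof
        assume "l = 0"
        then have "v = \<one>"
          using l AG v(1) ord_eq_1 by simp
        then have "x = \<one>"
          using v(2) by simp
        then have "ord x = 1"
          by simp
        then show False
          using x Suc by simp
      qed
      then have "ord x = 2 ^ (l - 1)"
        using ord_pow_prime_power[of v l 1] l AG v p_eq_2 by auto
      then have "l - 1 = n"
        using x by simp
      then have "l = Suc n"
        using \<open>l \<noteq> 0\<close> by simp
      then have "ord v = 2 ^ Suc n"
        using l by blast
      then show ?thesis
        using v by blast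
    qed
  qed
  then obtain x where x: "\<And>n. x n \<in> A" "\<And>n. ord (x n) = 2 ^ n" "\<And>n. x (Suc n) [^] (2::nat) = x n"
    by blast
  have carrier: "carrier (subgroup_generated G A) = A"
    using A by (rule subgroup.carrier_subgroup_generated_subgroup)
  have ord: "group.ord (subgroup_generated G A) a = ord a" if "a \<in> A" for a
    using group.ord_unique[OF group_subgroup_generated, of a A "ord a"] that AG carrier
    by (simp add: pow_subgroup_generated pow_eq_id)
  have "\<exists>n. \<exists>k::nat. a = x n [^] k" if a: "a \<in> A" for a
  proof -
    obtain n where "ord a = 2 ^ n"
      using order_power_two AG a by blast
    then have "a \<in> generate G {x n}"
      using one_cyclic_of_orderD[OF level x(1) a x(2)] by blast
    then show ?thesis
      using mem_generate_singleton_iff[OF AG[OF x(1)] ord_nonzero[OF AG[OF x(1)]]] by blast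
  qed
  then have "pruefer_chain (subgroup_generated G A) x"
    unfolding pruefer_chain_def carrier pow_subgroup_generated using x ord by simp
  then show ?thesis
    using that by blast
qed

text \<open>If the order \<open>2^n\<close> is missing, all larger orders are, since powers realize
  the smaller ones. By uniqueness an element of maximal order generates all others.\<close>

lemma exists_cyclic_generator:
  assumes A: "subgroup A G" and level: "\<And>k. one_cyclic_of_order A (2 ^ k)"
    and bounded: "\<not> (\<exists>a \<in> A. ord a = 2 ^ n)"
  obtains x m where "x \<in> A" "ord x = 2 ^ m" "A = generate G {x}"
proof -
  have AG: "a \<in> carrier G" if "a \<in> A" for a
    using A that by (rule subgroup.mem_carrier)
  have less: "m < n" if a: "a \<in> A" "ord a = 2 ^ m" for a m
  proof (rule ccontr)
    assume "\<not> m < n"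
    then have "ord (a [^] (2 ^ (m - n) :: nat)) = 2 ^ n"
      using ord_pow_prime_power[of a m "m - n"] a AG p_eq_2 by simp
    then show False
      using bounded nat_pow_mem_subgroup[OF A a(1)] by blast
  qed
  define M where "M = {m. \<exists>a \<in> A. ord a = 2 ^ m}"
  have fin: "finite M"
    by (rule finite_subset[of _ "{..<n}"]) (auto simp: M_def less)
  have "0 \<in> M"
    using subgroup.one_closed[OF A] by (auto simp: M_def intro!: bexI[of _ \<one>])
  then have "Max M \<in> M"
    using Max_in[OF fin] by blast
  then obtain x where x: "x \<in> A" "ord x = 2 ^ Max M"
    by (auto simp: M_def)
  have "a \<in> generate G {x}" if a: "a \<in> A" for a
  proof -
    obtain l where l: "ord a = 2 ^ l"
      using order_power_two AG a by blast
    then have "l \<le> Max M"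
      using a by (intro Max_ge[OF fin]) (auto simp: M_def)
    then have "a [^] (2 ^ Max M :: nat) = \<one>"
      using l AG[OF a] by (simp add: pow_eq_id le_imp_power_dvd)
    then show ?thesis
      using one_cyclic_mem[OF A _ x(1) _ a, of "Max M"] level x(2) p_eq_2 by simp
  qed
  moreover have "generate G {x} \<subseteq> A"
    using x(1) A by (intro generate_subgroup_incl) auto
  ultimately show ?thesis
    using that[OF x] by blast
qed

text \<open>With uniqueness at every level, the occurrence of all orders \<open>2^n\<close> in
  \<open>A\<close> decides between the infinite and the finite case.\<close>

lemma generalized_quaternion_if_noncommuting:
  assumes ab: "a \<in> carrier G" "b \<in> carrier G" "a \<otimes> b \<noteq> b \<otimes> a"
  shows "generalized_quaternion G"
proof -
  obtain i y where i: "i \<in> carrier G" "ord i = 4" and y: "y \<in> carrier G" "y \<notin> centralizer i"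
    "y \<otimes> y = z"
    and inverts: "\<And>c. c \<in> centralizer i \<Longrightarrow> inv y \<otimes> c \<otimes> y = inv c"
    and index: "\<And>g. g \<in> carrier G \<Longrightarrow> g \<notin> centralizer i \<Longrightarrow> g \<otimes> y \<in> centralizer i"
    by (rule index_two_inverted_centralizer[OF ab]) blast
  define A where "A = centralizer i"
  have A: "subgroup A G" "i \<in> A" "z \<in> A"
    using subgroup_centralizer i z_closed z_central by (auto simp: A_def centralizer_def)
  have AG: "c \<in> carrier G" if "c \<in> A" for c
    using A(1) that by (rule subgroup.mem_carrier)
  have level: "one_cyclic_of_order A (2 ^ k)" for k
    unfolding A_def using i by (rule order_four_centralizer)
  have generates: "carrier G \<subseteq> H" if H: "subgroup H G" "insert y A \<subseteq> H" for H
  proof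
    fix g assume g: "g \<in> carrier G"
    show "g \<in> H"
    proof (cases "g \<in> A")
      case False
      then have "(g \<otimes> y) \<otimes> inv y \<in> H"
        using index[OF g] H subgroup.m_closed[OF H(1)] subgroup.m_inv_closed[OF H(1)]
        by (auto simp: A_def)
      then show ?thesis
        using g y(1) by (simp add: m_assoc)
    qed (use H in blast)
  qed
  show ?thesis
  proof (cases "\<forall>n. \<exists>c \<in> A. ord c = 2 ^ n")
    case True
    then obtain x where "pruefer_chain (subgroup_generated G A) x"
      using exists_pruefer_chain[OF A(1) level] by blast
    then have pruefer: "subgroup_generated G A \<cong> pruefer_2_group"
      by (intro group.iso_if_pruefer_chain[OF group_subgroup_generated group_pruefer_2_group _
            pruefer_chain_pruefer_2_group])
    have gen: "carrier G = generate G (insert y A)"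
    proof
      show "carrier G \<subseteq> generate G (insert y A)"
        using y(1) AG by (intro generates generate_is_subgroup) (auto intro: generate.incl)
      show "generate G (insert y A) \<subseteq> carrier G"
        using y(1) AG by (intro generate_incl) auto
    qed
    have "rcosets A = {A, A #> y}"
    proof
      show "rcosets A \<subseteq> {A, A #> y}"
      proof
        fix C assume "C \<in> rcosets A"
        then obtain g where g: "g \<in> carrier G" "C = A #> g"
          by (auto simp: RCOSETS_def)
        show "C \<in> {A, A #> y}"
        proof (cases "g \<in> A")
          case True
          then show ?thesis
            using g coset_join2[OF g(1) A(1)] by simp
        next
          case False
          \<comment> \<open>As \<open>y^2 = z\<close> lies in \<open>A\<close>, so does
            \<open>g y^(-1)\<close>, which is membership of \<open>g\<close> in the coset of
            \<open>y\<close>.\<close>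
          then have "g \<otimes> y \<in> A"
            using index g(1) by (simp add: A_def)
          moreover have "inv (y \<otimes> y) \<in> A"
            using A y(3) subgroup.m_inv_closed by metis
          ultimately have "(g \<otimes> y) \<otimes> inv (y \<otimes> y) \<in> A"
            using A(1) by (simp add: subgroup.m_closed)
          then have "g \<otimes> inv y \<in> A"
            using g(1) y(1) by (simp add: inv_mult_group m_assoc) (metis inv_closed m_assoc r_inv l_one)
          then have "(g \<otimes> inv y) \<otimes> y \<in> A #> y"
            by (auto simp: r_coset_def)
          then have "g \<in> A #> y"
            using g(1) y(1) by (simp add: m_assoc)
          then show ?thesis
            using repr_independence[OF _ y(1) A(1)] g(2) by simp
        qed
      qed
      have "A \<in> rcosets A"
        using subgroup.subgroup_in_rcosets[OF A(1) is_group] .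
      then show "{A, A #> y} \<subseteq> rcosets A"
        using y(1) rcosetsI[OF _ y(1), of A] AG by auto
    qed
    moreover have "A \<noteq> A #> y"
      using rcos_self[OF y(1) A(1)] y(2) by (auto simp: A_def)
    ultimately have card: "card (rcosets A) = 2"
      by simp
    have "{c \<in> A. ord c = 2} = {z}"
    proof -
      have "c = z" if "c \<in> A" "ord c = 2" for c
      proof -
        have "c \<otimes> c = \<one>"
          using pow_ord_eq_1[OF AG[OF that(1)]] that AG by (simp add: numeral_2_eq_2)
        moreover have "c \<noteq> \<one>"
          using that(2) by auto
        ultimately show ?thesis
          using square_eq_one AG that(1) by blast
      qed
      then show ?thesis
        using A(3) ord_z unfolding p_eq_2 by blast
    qed
    moreover have "y [^] (2::nat) = z"
      using y by (simp add: numeral_2_eq_2)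
    ultimately have involution: "{c \<in> A. ord c = 2} = {y [^] (2::nat)}"
      by simp
    have "infinite_generalized_quaternion G"
      unfolding infinite_generalized_quaternion_def
      using is_group A(1) y(1) gen pruefer card involution inverts[folded A_def] by blast
    then show ?thesis
      by (simp add: generalized_quaternion_def)
  next
    case False
    then obtain x m where x: "x \<in> A" "ord x = 2 ^ m" and A_gen: "A = generate G {x}"
      using exists_cyclic_generator[OF A(1) level] by metis
    note xG = AG[OF x(1)]
    \<comment> \<open>The element \<open>i\<close> of order 4 lies in \<open>A\<close>; this gives
      the bound 3 on the parameter \<open>m + 1\<close>.\<close>
    have "m \<ge> 2"
    proof -
      obtain k where "i = x [^] (k::nat)"
        using A(2) A_gen mem_generate_singleton_iff[OF xG ord_nonzero[OF xG]] by blast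
      then have "i [^] (2 ^ m :: nat) = \<one>"
        using x(2) xG by (metis mult.commute nat_pow_one nat_pow_pow pow_ord_eq_1)
      then have "2 ^ 2 dvd (2 ^ m :: nat)"
        using i by (simp add: pow_eq_id)
      then show ?thesis
        using power_dvd_imp_le[of "2 :: nat" 2 m] by simp
    qed
    have "x [^] (2 ^ (m - 1) :: nat) = z"
    proof -
      have "ord (x [^] (2 ^ (m - 1) :: nat)) = 2"
        using ord_pow_prime_power[OF xG, of m "m - 1"] x(2) p_eq_2 \<open>m \<ge> 2\<close> by simp
      then have "x [^] (2 ^ (m - 1) :: nat) \<noteq> \<one>"
        "x [^] (2 ^ (m - 1) :: nat) \<otimes> x [^] (2 ^ (m - 1) :: nat) = \<one>"
        using pow_ord_eq_1[of "x [^] (2 ^ (m - 1) :: nat)"] xG by (auto simp: numeral_2_eq_2)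
      then show ?thesis
        using square_eq_one xG by blast
    qed
    \<comment> \<open>The relations prescribe \<open>x\<close> of order \<open>2^(n - 1)\<close>, so
      \<open>n = m + 1\<close>; then \<open>n - 2 = m - 1\<close> is the exponent in
      \<open>x^(2^(m - 1)) = z = y^2\<close>.\<close>
    then have "G \<cong> quaternion_group (m + 1)"
    proof (intro iso_quaternion_group[OF xG _ y(1)])
      show "carrier G = generate G {x, y}"
      proof
        have "A \<subseteq> generate G {x, y}"
          unfolding A_gen by (rule mono_generate) simp
        then show "carrier G \<subseteq> generate G {x, y}"
          using y(1) xG by (intro generates generate_is_subgroup) (auto intro: generate.incl)
        show "generate G {x, y} \<subseteq> carrier G"
          using y(1) xG by (intro generate_incl) auto
      qed
    qed (use x y inverts A_gen A_def in auto)
    then show ?thesis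
      using \<open>m \<ge> 2\<close> by (auto simp: generalized_quaternion_def intro!: exI[of _ "m + 1"])
  qed
qed

end

section \<open>From the complete graph to a unique subgroup of prime order\<close>

theorem theorem3p3:
  fixes G :: "('a, 'b) monoid_scheme"
  assumes "group G"
    and "torsion_group G"
    and "\<not> comm_group G"
    and "complete_graph (generalized_power_graph G)"
    and "locally_finite_group G"
  shows "generalized_quaternion G"
proof -
  interpret group G
    by (rule assms(1))
  obtain a b where ab: "a \<in> carrier G" "b \<in> carrier G" "a \<otimes>\<^bsub>G\<^esub> b \<noteq> b \<otimes>\<^bsub>G\<^esub> a"
    using assms(3) group_comm_groupI by blast
  have torsion: "ord g \<noteq> 0" if "g \<in> carrier G" for g
    using assms(2) that ord_eq_0[OF that] by (auto simp: torsion_group_def)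
  have "a \<noteq> \<one>\<^bsub>G\<^esub>"
    using ab by auto
  then have "ord a \<noteq> 1"
    using ab(1) ord_eq_1 by blast
  then obtain p where p: "prime p" "p dvd ord a"
    using prime_factor_nat by blast
  \<comment> \<open>The choice of \<open>a\<close> and \<open>p\<close> will not matter, since
    completeness puts \<open>z\<close> into every nontrivial cyclic subgroup.\<close>
  define z where "z = a [^]\<^bsub>G\<^esub> (ord a div p)"
  have zG: "z \<in> carrier G"
    using ab(1) by (simp add: z_def)
  have ord_z: "ord z = p"
    unfolding z_def using ab(1) p torsion[OF ab(1)] by (subst ord_pow) auto
  interpret unique_prime_order_group G p z
  proof unfold_locales
    fix g assume g: "g \<in> carrier G" "g \<noteq> \<one>\<^bsub>G\<^esub>"
    show "z \<in> generate G {g}"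
    \<comment> \<open>Adjacency relates distinct vertices only, so \<open>g = z\<close> is a
      separate case.\<close>
    proof (cases "g = z")
      case False
      have "z \<noteq> \<one>\<^bsub>G\<^esub>"
        using ord_z p(1) by auto
      then have "generate G {z} \<inter> generate G {g} \<noteq> {\<one>\<^bsub>G\<^esub>}"
        using assms(4) False g zG
        by (auto simp: complete_graph_def generalized_power_graph_def)
      then obtain w where w: "w \<in> generate G {z}" "w \<in> generate G {g}" "w \<noteq> \<one>\<^bsub>G\<^esub>"
        using generate.one by blast
      have wG: "w \<in> carrier G"
        using w(1) generate_incl[of "{z}"] zG by auto
      obtain n where "w = z [^]\<^bsub>G\<^esub> (n::nat)"
        using w(1) mem_generate_singleton_iff[OF zG torsion[OF zG]] by blast
      then have "w [^]\<^bsub>G\<^esub> p = \<one>\<^bsub>G\<^esub>"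
        using ord_z zG by (metis mult.commute nat_pow_one nat_pow_pow pow_ord_eq_1)
      \<comment> \<open>A nontrivial element of a group of prime order generates it, so
        \<open>w\<close> recovers \<open>z\<close> inside \<open><g>\<close>.\<close>
      then have "ord w = p"
        using p(1) wG w(3) by (metis ord_eq_1 pow_eq_id prime_nat_iff)
      then have "z \<in> generate G {w}"
        using generate_singleton_sym[OF zG _ torsion[OF zG] w(1)] ord_z by simp
      then show ?thesis
        using generate_singleton_mono[OF g(1) w(2)] by blast
    qed (simp add: generate.incl)
  next
    fix S assume "S \<subseteq> carrier G" "finite S"
    then show "finite (generate G S)"
      using assms(5) by (simp add: locally_finite_group_def)
  qed (use p(1) zG ord_z in auto)
  \<comment> \<open>For odd \<open>p\<close> all levels hold on the whole of \<open>G\<close>, which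
    would make \<open>a\<close> and \<open>b\<close> commute.\<close>
  have "p = 2"
  proof (rule ccontr)
    assume "p \<noteq> 2"
    then have "odd p"
      using p(1) primes_dvd_imp_eq two_is_prime_nat by blast
    then show False
      using commute_if_one_cyclic[OF subgroup_self one_cyclic_all[OF subgroup_self]] ab by blast
  qed
  then interpret unique_involution_group G p z
    by unfold_locales
  show ?thesis
    using ab by (rule generalized_quaternion_if_noncommuting)
qed

end
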